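(* Let $R>1$, let $u$ be a ($C^2$, real valued) function on $S_{1,\sqrt{R}}^{-\pi,3\pi}$ with separation $w$, where $w\neq 0$, and set $f=u_x-i\,u_y$. Let $C>0$ and $0<\epsilon<1/(2\pi)$ be constants such that $$|f(\zeta)|\leq C\,|\zeta|^{-5/12},\qquad |\Delta u(\zeta)|\leq C\,|\zeta|^{-9/4}\qquad\text{for }\zeta\in S_{1,\sqrt{R}}^{-\pi,3\pi},$$ and $$\rho\,\frac{|\nabla w|}{|w|}\leq \epsilon<\frac{1}{2\pi}\qquad\text{on }S_{1,\sqrt{R}}^{-\pi,\pi}.$$ Then there is a constant $C_1$ depending only on $C$ such that for every $r_1\geq 1$ with $2r_1\le \sqrt{R}/2$ there are $b,c\in\mathbf{R}$ such that for all $\zeta\in S_{2r_1,\sqrt{R}/2}^{0,2\pi}$ $$f(\zeta)=\Big(b+\frac{i\,c}{2\pi}\Big)\,\zeta^{-1}+g(\zeta),$$ where $$|g(\zeta)|\leq C_1\,R^{-5/24}+C_1\,r_1^{-1/4}\,|\zeta|^{-1}+C_1\,\epsilon\,r_1^{-1}\,|w(r_1,0)|.$$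
   Context: Let $\mathcal{P}$ be the universal cover of the punctured plane $\mathbf{C}\setminus\{0\}$, with global polar coordinates $(\rho,\theta)$, $\rho>0$, $\theta\in\mathbf{R}$. For $r_1\le r_2$ and $\theta_1\le\theta_2$ let $S_{r_1,r_2}^{\theta_1,\theta_2}=\{(\rho,\theta)\in\mathcal{P}\mid r_1\leq\rho\leq r_2,\ \theta_1\leq\theta\leq\theta_2\}$. A point $\zeta=(\rho,\theta)$ is identified, when used in algebraic expressions such as $\zeta^{-1}$, with the complex number $\rho e^{i\theta}$, and $|\zeta|=\rho$. The gradient, the Laplacian $\Delta$ and the partial derivatives $u_x,u_y$ are the Euclidean ones, taken with respect to the local coordinates $x=\rho\cos\theta$, $y=\rho\sin\theta$ (the flat metric pulled back to $\mathcal{P}$). Functions on subsets of $\mathcal{P}$ are thought of as multi-valued functions on the punctured plane. The separation of $u$ is $w(\rho,\theta)=u(\rho,\theta+2\pi)-u(\rho,\theta)$; for $u$ on $S_{1,\sqrt R}^{-\pi,3\pi}$ it is defined on $S_{1,\sqrt R}^{-\pi,\pi}$. *)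

theory Defs
  imports "HOL-Analysis.Analysis"
begin

text \<open>
  The universal cover of the punctured plane is modelled by the pairs (\<rho>, \<theta>) of global polar
  coordinates. Functions on (subsets of) the cover are total functions on \<open>real \<times> real\<close> whose
  values elsewhere are irrelevant.
\<close>

definition univ_cover :: "(real \<times> real) set" where
  "univ_cover = {\<zeta>. fst \<zeta> > 0}"

definition polar_sector :: "real \<Rightarrow> real \<Rightarrow> real \<Rightarrow> real \<Rightarrow> (real \<times> real) set" where
  "polar_sector r1 r2 \<theta>1 \<theta>2 =
     {\<zeta> \<in> univ_cover. r1 \<le> fst \<zeta> \<and> fst \<zeta> \<le> r2 \<and> \<theta>1 \<le> snd \<zeta> \<and> snd \<zeta> \<le> \<theta>2}"

definition cover_proj :: "real \<times> real \<Rightarrow> complex" where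
  "cover_proj \<zeta> = rcis (fst \<zeta>) (snd \<zeta>)"

text \<open>
  The local inverse of the covering map that takes its angles in \<open>{\<theta>0 - pi<..\<theta>0 + pi}\<close>. It is smooth
  away from the ray opposite to \<open>\<theta>0\<close>, so near a point with angle \<open>\<theta>0\<close> it expresses the
  cover in the local coordinates x, y.
\<close>

definition local_lift :: "real \<Rightarrow> complex \<Rightarrow> real \<times> real" where
  "local_lift \<theta>0 z = (cmod z, \<theta>0 + Arg (z * cis (- \<theta>0)))"

lemma cover_proj_local_lift: "cover_proj (local_lift \<theta>0 z) = z"
proof -
  have "rcis (cmod z) (\<theta>0 + Arg (z * cis (- \<theta>0)))
      = cis \<theta>0 * rcis (cmod (z * cis (- \<theta>0))) (Arg (z * cis (- \<theta>0)))"
    by (simp add: rcis_def norm_mult mult.left_commute flip: cis_mult)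
  also have "\<dots> = z"
    by (simp only: rcis_cmod_Arg) (simp add: cis_mult mult.left_commute)
  finally show ?thesis
    by (simp add: cover_proj_def local_lift_def)
qed

lemma local_lift_cover_proj: "\<zeta> \<in> univ_cover \<Longrightarrow> local_lift (snd \<zeta>) (cover_proj \<zeta>) = \<zeta>"
  by (cases \<zeta>)
     (simp add: univ_cover_def cover_proj_def local_lift_def rcis_def cis_mult mult.assoc norm_mult)

definition partial_x :: "(real \<times> real \<Rightarrow> real) \<Rightarrow> real \<times> real \<Rightarrow> real" where
  "partial_x u \<zeta> = deriv (\<lambda>t. u (local_lift (snd \<zeta>) (cover_proj \<zeta> + of_real t))) 0"

definition partial_y :: "(real \<times> real \<Rightarrow> real) \<Rightarrow> real \<times> real \<Rightarrow> real" where
  "partial_y u \<zeta> = deriv (\<lambda>t. u (local_lift (snd \<zeta>) (cover_proj \<zeta> + \<i> * of_real t))) 0"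

definition gradient :: "(real \<times> real \<Rightarrow> real) \<Rightarrow> real \<times> real \<Rightarrow> real \<times> real" where
  "gradient u \<zeta> = (partial_x u \<zeta>, partial_y u \<zeta>)"

definition laplacian :: "(real \<times> real \<Rightarrow> real) \<Rightarrow> real \<times> real \<Rightarrow> real" where
  "laplacian u \<zeta> = partial_x (partial_x u) \<zeta> + partial_y (partial_y u) \<zeta>"

text \<open>
  Since (\<rho>, \<theta>) are smooth coordinates on the cover, differentiability may be tested in them.
\<close>

definition C1_open :: "(real \<times> real) set \<Rightarrow> (real \<times> real \<Rightarrow> real) \<Rightarrow> bool" where
  "C1_open U u \<longleftrightarrow>
     u differentiable_on U \<and> continuous_on U (partial_x u) \<and> continuous_on U (partial_y u)"

definition C2_open :: "(real \<times> real) set \<Rightarrow> (real \<times> real \<Rightarrow> real) \<Rightarrow> bool" where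
  "C2_open U u \<longleftrightarrow> C1_open U u \<and> C1_open U (partial_x u) \<and> C1_open U (partial_y u)"

text \<open>
  As usual, being \<open>C\<^sup>2\<close> on a subset that is not open means being \<open>C\<^sup>2\<close> on some open neighbourhood of
  it in the cover. On a closed sector with nonempty interior the derivatives up to second order
  at points of the sector are determined by the values on the sector.
\<close>

definition C2_on :: "(real \<times> real) set \<Rightarrow> (real \<times> real \<Rightarrow> real) \<Rightarrow> bool" where
  "C2_on S u \<longleftrightarrow> (\<exists>U. open U \<and> S \<subseteq> U \<and> U \<subseteq> univ_cover \<and> C2_open U u)"

definition separation :: "(real \<times> real \<Rightarrow> real) \<Rightarrow> real \<times> real \<Rightarrow> real" where
  "separation u \<zeta> = u (fst \<zeta>, snd \<zeta> + 2 * pi) - u \<zeta>"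

definition complex_gradient :: "(real \<times> real \<Rightarrow> real) \<Rightarrow> real \<times> real \<Rightarrow> complex" where
  "complex_gradient u \<zeta> = of_real (partial_x u \<zeta>) - \<i> * of_real (partial_y u \<zeta>)"

end

theory Submission
  imports Defs
begin

text \<open>
  In logarithmic coordinates \<open>\<zeta> = e\<^sup>s\<^sup>+\<^sup>i\<^sup>t\<close> the function \<open>h = \<zeta> f\<close> satisfies
  \<open>h\<^sub>s + i h\<^sub>t = \<bar>\<zeta>\<bar>\<^sup>2 \<Delta>u\<close>, and \<open>h (s, t + 2\<pi>) - h (s, t)\<close> has modulus \<open>\<bar>\<zeta>\<bar> \<bar>\<nabla>w\<bar> \<le> \<epsilon> \<bar>w\<bar>\<close>. The Cauchy--Pompeiu
  formula on the annulus slit along the ray opposite to \<open>\<zeta>\<close> becomes a statement about the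
  \<open>2\<pi>i\<close>-periodic kernel \<open>1 / (e\<^sup>\<tau> - 1)\<close> on a strip of height \<open>2\<pi>\<close>. Its pairing with \<open>h\<close> over a
  vertical segment, taken with the reflected kernel \<open>1 / (e\<^sup>-\<^sup>\<tau> - 1)\<close> to the left of the pole, varies in \<open>s\<close>
  only through the Laplacian and the jump across the slit and is small at the two ends of the strip,
  while its two limits at the pole add up to \<open>2\<pi> h\<close> minus the integral of \<open>h\<close> over
  the segment. That integral is in turn almost independent of \<open>s \<ge> ln r\<^sub>1\<close> and of the position of the slit,
  so its value at \<open>r\<^sub>1\<close> divided by \<open>2\<pi>\<close> serves as the coefficient of \<open>\<zeta>\<^sup>-\<^sup>1\<close>. The separation grows
  at most like \<open>\<rho>\<^sup>\<epsilon>\<close> since its logarithmic derivative is bounded by \<open>\<epsilon>\<close>.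
\<close>

subsection \<open>The periodic Cauchy kernel\<close>

lemma continuous_on_uncurry:
  assumes "continuous_on (A \<times> B) (\<lambda>(s, t). h s t)"
    and "continuous_on S f" "continuous_on S g"
    and "\<And>x. x \<in> S \<Longrightarrow> f x \<in> A" "\<And>x. x \<in> S \<Longrightarrow> g x \<in> B"
  shows "continuous_on S (\<lambda>x. h (f x) (g x))"
  using continuous_on_compose2[OF assms(1) continuous_on_Pair[OF assms(2,3)]] assms(4,5) by auto

text \<open>With \<tau> = \<sigma> + i \<phi> this has simple poles at the multiples of 2 \<pi> i.
  It decays like exp (- \<sigma>) to the right but tends to -1 to the left, so the estimates use it
  for \<sigma> \<ge> 0 and reach the left half of a strip by reflecting the arguments of
  \<open>h\<close>.\<close>

definition kern :: "real \<Rightarrow> real \<Rightarrow> complex" where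
  "kern \<sigma> \<phi> = inverse (exp (Complex \<sigma> \<phi>) - 1)"

lemma exp_neq_1: "\<sigma> > 0 \<Longrightarrow> exp (Complex \<sigma> \<phi>) \<noteq> 1"
  using norm_exp_eq_Re[of "Complex \<sigma> \<phi>"] by (auto simp del: norm_exp_eq_Re)

text \<open>The two nonnegative summands separate the radial from the angular distance to the pole,
  so each can be bounded below on its own.\<close>

lemma norm_exp_minus_1_sq:
  "(cmod (exp (Complex \<sigma> \<phi>) - 1))\<^sup>2 = (exp \<sigma> - 1)\<^sup>2 + 2 * exp \<sigma> * (1 - cos \<phi>)"
proof -
  have "(exp \<sigma> * cos \<phi> - 1)\<^sup>2 + (exp \<sigma> * sin \<phi>)\<^sup>2 =
     (exp \<sigma>)\<^sup>2 * ((sin \<phi>)\<^sup>2 + (cos \<phi>)\<^sup>2) - 2 * exp \<sigma> * cos \<phi> + 1"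
    by (simp only: power2_eq_square algebra_simps)
  then show ?thesis
    by (simp add: cmod_power2 Re_exp Im_exp) (simp add: power2_eq_square algebra_simps)
qed

lemma Complex_has_vector_derivative_Re [derivative_intros]:
  "((\<lambda>s. Complex s t) has_vector_derivative 1) (at s within S)"
  unfolding Complex_eq by (auto intro!: derivative_eq_intros)

lemma Complex_has_vector_derivative_Im [derivative_intros]:
  "((\<lambda>t. Complex s t) has_vector_derivative \<i>) (at t within S)"
  unfolding Complex_eq by (auto intro!: derivative_eq_intros)

lemma kern_has_vector_derivative:
  assumes "\<sigma> > 0"
  shows "((\<lambda>\<sigma>. kern \<sigma> \<phi>) has_vector_derivative
      - exp (Complex \<sigma> \<phi>) * (kern \<sigma> \<phi>)\<^sup>2) (at \<sigma> within S)"
    and "((\<lambda>\<phi>. kern \<sigma> \<phi>) has_vector_derivative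
      - \<i> * exp (Complex \<sigma> \<phi>) * (kern \<sigma> \<phi>)\<^sup>2) (at \<phi> within T)"
proof -
  have *: "((\<lambda>z. inverse (exp z - 1)) has_field_derivative
      - exp (Complex \<sigma> \<phi>) * (kern \<sigma> \<phi>)\<^sup>2) (at (Complex \<sigma> \<phi>))"
    using exp_neq_1[OF assms, of \<phi>]
    by (auto intro!: derivative_eq_intros simp: kern_def power2_eq_square field_simps)
  show "((\<lambda>\<sigma>. kern \<sigma> \<phi>) has_vector_derivative
      - exp (Complex \<sigma> \<phi>) * (kern \<sigma> \<phi>)\<^sup>2) (at \<sigma> within S)"
    using field_vector_diff_chain_within[OF Complex_has_vector_derivative_Re
        has_field_derivative_at_within[OF *], of S]
    by (simp add: o_def kern_def)
  show "((\<lambda>\<phi>. kern \<sigma> \<phi>) has_vector_derivative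
      - \<i> * exp (Complex \<sigma> \<phi>) * (kern \<sigma> \<phi>)\<^sup>2) (at \<phi> within T)"
    using field_vector_diff_chain_within[OF Complex_has_vector_derivative_Im
        has_field_derivative_at_within[OF *], of T]
    by (simp add: o_def kern_def mult.assoc)
qed

lemma continuous_on_kern [continuous_intros]:
  assumes "continuous_on S f" "continuous_on S g" "\<And>x. x \<in> S \<Longrightarrow> f x > 0"
  shows "continuous_on S (\<lambda>x. kern (f x) (g x))"
  unfolding kern_def using assms exp_neq_1
  by (auto intro!: continuous_intros simp: Complex_eq)

text \<open>For \<sigma> > 0 the kernel is the sum of exp (- n \<tau>) over n \<ge> 1, without a
  constant term. In closed form, Ln (1 - exp (- \<tau>)) is a 2 \<pi> i-periodic primitive; the
  argument of Ln stays in the right half plane, away from the branch cut.\<close>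

lemma kern_has_integral_0:
  assumes "\<sigma> > 0"
  shows "(kern \<sigma> has_integral 0) {-pi..pi}"
proof -
  define F where "F = (\<lambda>\<phi>. - \<i> * Ln (1 - exp (- Complex \<sigma> \<phi>)))"
  have "(F has_vector_derivative kern \<sigma> \<phi>) (at \<phi> within {-pi..pi})" for \<phi>
  proof -
    have "Re (exp (- Complex \<sigma> \<phi>)) < 1"
      using complex_Re_le_cmod[of "exp (- Complex \<sigma> \<phi>)"] norm_exp_eq_Re[of "- Complex \<sigma> \<phi>"] assms
      by (auto simp del: norm_exp_eq_Re intro: le_less_trans)
    then have "1 - exp (- Complex \<sigma> \<phi>) \<notin> \<real>\<^sub>\<le>\<^sub>0"
      by (auto simp: complex_nonpos_Reals_iff)
    then have *: "((\<lambda>z. - \<i> * Ln (1 - exp (- z))) has_field_derivative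
        - \<i> * (exp (- Complex \<sigma> \<phi>) / (1 - exp (- Complex \<sigma> \<phi>)))) (at (Complex \<sigma> \<phi>))"
      by (auto intro!: derivative_eq_intros simp: divide_inverse)
    have "\<i> * (- \<i> * (exp (- Complex \<sigma> \<phi>) / (1 - exp (- Complex \<sigma> \<phi>)))) = kern \<sigma> \<phi>"
      using exp_neq_1[OF assms, of \<phi>] by (simp add: kern_def exp_minus field_simps)
    then show ?thesis
      using field_vector_diff_chain_within[OF Complex_has_vector_derivative_Im
        has_field_derivative_at_within[OF *], of "{-pi..pi}"]
      by (simp add: o_def F_def)
  qed
  then have "(kern \<sigma> has_integral F pi - F (- pi)) {-pi..pi}"
    by (intro fundamental_theorem_of_calculus) auto
  moreover have "exp (- Complex \<sigma> pi) = exp (- Complex \<sigma> (- pi))"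
    by (simp add: complex_eq_iff Re_exp Im_exp)
  ultimately show ?thesis by (simp add: F_def)
qed

text \<open>For z = exp \<tau> one has 1 + 2 Re (1 / (z - 1)) = Re ((z + 1) / (z - 1)) = (|z|^2 - 1)
  / |z - 1|^2, which is the Poisson kernel. The squared modulus is therefore affine in the real
  part, whose integral is known.\<close>

lemma kern_norm_sq:
  assumes "\<sigma> > 0"
  shows "(cmod (kern \<sigma> \<phi>))\<^sup>2 = (1 + 2 * Re (kern \<sigma> \<phi>)) / (exp (2 * \<sigma>) - 1)"
proof -
  define n where "n = (cmod (exp (Complex \<sigma> \<phi>) - 1))\<^sup>2"
  have n: "n > 0" using exp_neq_1[OF assms, of \<phi>] by (auto simp: n_def)
  have e: "exp (2 * \<sigma>) = (exp \<sigma>)\<^sup>2" by (simp add: exp_double)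
  have "exp (2*\<sigma>) > 1" using assms by simp
  then have m: "(exp \<sigma>)\<^sup>2 - 1 > 0" unfolding e by simp
  have "Re (kern \<sigma> \<phi>) = (exp \<sigma> * cos \<phi> - 1) / n"
    by (simp add: kern_def n_def cmod_power2 Re_exp)
  then have "1 + 2 * Re (kern \<sigma> \<phi>) = (n + 2 * (exp \<sigma> * cos \<phi> - 1)) / n"
    using n by (simp add: field_simps)
  moreover have "n = (exp \<sigma> - 1)\<^sup>2 + 2 * exp \<sigma> * (1 - cos \<phi>)"
    unfolding n_def by (rule norm_exp_minus_1_sq)
  then have "n + 2 * (exp \<sigma> * cos \<phi> - 1) = (exp \<sigma>)\<^sup>2 - 1"
    by (simp add: power2_eq_square algebra_simps)
  moreover have "((exp \<sigma>)\<^sup>2 - 1) / n = (cmod (kern \<sigma> \<phi>))\<^sup>2 * ((exp \<sigma>)\<^sup>2 - 1)"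
    by (simp add: kern_def n_def norm_inverse power_inverse divide_inverse)
  ultimately have "1 + 2 * Re (kern \<sigma> \<phi>) = (cmod (kern \<sigma> \<phi>))\<^sup>2 * ((exp \<sigma>)\<^sup>2 - 1)"
    by (simp only:)
  then show ?thesis using m unfolding e by simp
qed

text \<open>Cauchy--Schwarz (as pointwise AM--GM) reduces the \<open>L\<^sup>1\<close> norm to the \<open>L\<^sup>2\<close> norm, which
  \<open>kern_norm_sq\<close> and \<open>kern_has_integral_0\<close> evaluate exactly.\<close>

lemma integral_norm_kern_le:
  assumes "\<sigma> > 0"
  shows "integral {-pi..pi} (\<lambda>\<phi>. cmod (kern \<sigma> \<phi>)) \<le> 2 * pi / sqrt (exp (2 * \<sigma>) - 1)"
proof -
  define m where "m = sqrt (exp (2 * \<sigma>) - 1)"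
  have m: "m > 0" "m\<^sup>2 = exp (2 * \<sigma>) - 1" using assms by (simp_all add: m_def)
  \<comment> \<open>From 2 m |kern| \<le> 1 + m^2 |kern|^2 and m^2 |kern|^2 = 1 + 2 Re kern one gets
    |kern| \<le> (1 + Re kern) / m.\<close>
  define B where "B = (\<lambda>\<phi>. (1 + Re (kern \<sigma> \<phi>)) / m)"
  have "((\<lambda>\<phi>. Re (kern \<sigma> \<phi>)) has_integral 0) {-pi..pi}"
    using has_integral_Re[OF kern_has_integral_0[OF assms]] by simp
  then have "((\<lambda>\<phi>. 1 + Re (kern \<sigma> \<phi>)) has_integral (2 * pi + 0)) {-pi..pi}"
    using has_integral_const_real[of "1::real" "-pi" pi] by (intro has_integral_add) auto
  then have B: "(B has_integral 2 * pi / m) {-pi..pi}"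
    unfolding B_def by (drule_tac has_integral_divide[where c=m]) simp
  have "cmod (kern \<sigma> \<phi>) \<le> B \<phi>" for \<phi>
  proof -
    have "0 \<le> (m * cmod (kern \<sigma> \<phi>) - 1)\<^sup>2" by simp
    also have "\<dots> = m\<^sup>2 * (cmod (kern \<sigma> \<phi>))\<^sup>2 - 2 * (m * cmod (kern \<sigma> \<phi>)) + 1"
      by (simp add: power2_eq_square algebra_simps)
    also have "m\<^sup>2 * (cmod (kern \<sigma> \<phi>))\<^sup>2 = 1 + 2 * Re (kern \<sigma> \<phi>)"
      using m kern_norm_sq[OF assms, of \<phi>] assms by simp
    finally show ?thesis using m by (simp add: B_def field_simps)
  qed
  then have "integral {-pi..pi} (\<lambda>\<phi>. cmod (kern \<sigma> \<phi>)) \<le> integral {-pi..pi} B"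
    using B assms
    by (intro integral_le) (auto simp: has_integral_integrable intro!: integrable_continuous_real continuous_intros)
  then show ?thesis using B by (simp add: m_def integral_unique)
qed

text \<open>On the slit exp \<tau> is a negative real number, so the kernel stays bounded up to
  \<sigma> = 0 and decays exponentially. This is the weight with which the jump of \<open>h\<close>
  is integrated.\<close>

lemma norm_kern_pi: "cmod (kern \<sigma> pi) = 1 / (exp \<sigma> + 1)"
proof -
  have "exp (Complex \<sigma> pi) - 1 = - of_real (exp \<sigma> + 1)"
    by (simp add: complex_eq_iff Re_exp Im_exp)
  then have *: "cmod (exp (Complex \<sigma> pi) - 1) = \<bar>exp \<sigma> + 1\<bar>"
    by (simp only: norm_minus_cancel norm_of_real)
  have "\<bar>exp \<sigma> + 1\<bar> = exp \<sigma> + 1"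
    by (intro abs_of_pos) (simp add: add_pos_pos)
  then show ?thesis
    unfolding kern_def norm_inverse * by (simp add: divide_inverse)
qed

lemma kern_pi_eq: "kern \<sigma> (- pi) = kern \<sigma> pi"
proof -
  have "exp (Complex \<sigma> pi) = exp (Complex \<sigma> (- pi))"
    by (simp add: complex_eq_iff Re_exp Im_exp)
  then show ?thesis by (simp add: kern_def)
qed

text \<open>Since 1 - cos \<phi> = 2 sin^2 (\<phi> / 2), it suffices that sin x \<ge> x / 2 on
  [0, 1.6], an interval containing [0, \<pi> / 2]. The Taylor error x^3 / 6 is at most x / 2 there
  because 1.6^2 < 3.\<close>

lemma one_minus_cos_ge:
  assumes "\<bar>\<phi>\<bar> \<le> pi"
  shows "\<phi>\<^sup>2 / 8 \<le> 1 - cos \<phi>"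
proof -
  define x where "x = \<bar>\<phi>\<bar> / 2"
  have "pi \<le> 3.2" using pi_approx by simp
  then have x: "0 \<le> x" "x \<le> 1.6" using assms by (auto simp: x_def)
  have "\<bar>sin x - (\<Sum>m<3. sin_coeff m * x ^ m)\<bar> \<le> inverse (fact 3) * \<bar>x\<bar> ^ 3"
    by (rule Maclaurin_sin_bound)
  then have "\<bar>sin x - x\<bar> \<le> x ^ 3 / 6"
    using x by (simp add: eval_nat_numeral sin_coeff_def field_simps)
  moreover have "x ^ 3 / 6 \<le> x / 2"
  proof -
    have "x * x \<le> 1.6 * 1.6" using x by (intro mult_mono) auto
    then have "x * (x * x) \<le> x * 3" using x by (intro mult_left_mono) auto
    then show ?thesis by (simp add: power3_eq_cube)
  qed
  ultimately have "x / 2 \<le> sin x" by linarith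
  then have "(x / 2)\<^sup>2 \<le> (sin x)\<^sup>2" using x by (intro power_mono) auto
  moreover have "1 - cos \<phi> = 2 * (sin x)\<^sup>2"
    using cos_double_sin[of x] by (simp add: x_def)
  moreover have "\<phi>\<^sup>2 / 8 = 2 * (x / 2)\<^sup>2" by (simp add: x_def power2_eq_square)
  ultimately show ?thesis by linarith
qed

text \<open>The singularity is of first order, with a constant uniform in \<sigma>. A Lipschitz
  function vanishing at the pole therefore has a bounded product with the kernel, which supplies the
  dominating constant for the limit \<sigma> \<rightarrow> 0.\<close>

lemma norm_kern_mult_le:
  assumes "\<sigma> > 0" "\<bar>\<phi>\<bar> \<le> pi"
  shows "cmod (kern \<sigma> \<phi>) * (\<sigma> + \<bar>\<phi>\<bar>) \<le> 4"
proof -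
  have 1: "\<sigma>\<^sup>2 \<le> (exp \<sigma> - 1)\<^sup>2"
    using assms exp_ge_add_one_self[of \<sigma>] by (intro power_mono) linarith+
  have "1 * (\<phi>\<^sup>2 / 8) \<le> exp \<sigma> * (1 - cos \<phi>)"
    using assms one_minus_cos_ge[of \<phi>] by (intro mult_mono) auto
  then have "\<sigma>\<^sup>2 + \<phi>\<^sup>2 / 4 \<le> (cmod (exp (Complex \<sigma> \<phi>) - 1))\<^sup>2"
    using 1 by (simp add: norm_exp_minus_1_sq)
  moreover have "(\<sigma> + \<bar>\<phi>\<bar>)\<^sup>2 \<le> 16 * (\<sigma>\<^sup>2 + \<phi>\<^sup>2 / 4)"
  proof -
    have "(a + b)\<^sup>2 \<le> 16 * (a\<^sup>2 + b\<^sup>2 / 4)" for a b :: real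
    proof -
      have "16 * (a\<^sup>2 + b\<^sup>2 / 4) - (a + b)\<^sup>2 = (a - b)\<^sup>2 + 14 * a\<^sup>2 + 2 * b\<^sup>2"
        by (simp add: power2_eq_square algebra_simps)
      moreover have "\<dots> \<ge> 0" by simp
      ultimately show ?thesis by linarith
    qed
    from this[of \<sigma> "\<bar>\<phi>\<bar>"] show ?thesis by simp
  qed
  ultimately have "(\<sigma> + \<bar>\<phi>\<bar>)\<^sup>2 \<le> (4 * cmod (exp (Complex \<sigma> \<phi>) - 1))\<^sup>2"
    by (simp add: power_mult_distrib)
  then have "\<sigma> + \<bar>\<phi>\<bar> \<le> 4 * cmod (exp (Complex \<sigma> \<phi>) - 1)"
    by (rule power2_le_imp_le) simp
  moreover have "0 < cmod (exp (Complex \<sigma> \<phi>) - 1)" using exp_neq_1[OF assms(1), of \<phi>] by simp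
  ultimately have "inverse (cmod (exp (Complex \<sigma> \<phi>) - 1)) * (\<sigma> + \<bar>\<phi>\<bar>) \<le>
      inverse (cmod (exp (Complex \<sigma> \<phi>) - 1)) * (4 * cmod (exp (Complex \<sigma> \<phi>) - 1))"
    by (intro mult_left_mono) auto
  also have "\<dots> = 4" using exp_neq_1[OF assms(1), of \<phi>] by simp
  finally show ?thesis by (simp add: kern_def norm_inverse)
qed

text \<open>On the imaginary axis the kernel equals -1/2 - (i/2) cot (\<phi> / 2): a constant plus
  an odd function carrying the whole singularity, which cancels under reflection.\<close>

lemma kern_imaginary_add:
  assumes "\<bar>\<phi>\<bar> \<le> pi" "\<phi> \<noteq> 0"
  shows "kern 0 \<phi> + kern 0 (- \<phi>) = - 1" "exp (Complex 0 \<phi>) \<noteq> 1"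
proof -
  have "0 < \<phi>\<^sup>2 / 8" using assms by simp
  then have "cos \<phi> \<noteq> 1" using one_minus_cos_ge[OF assms(1)] by linarith
  then show ne: "exp (Complex 0 \<phi>) \<noteq> 1"
    by (auto simp: complex_eq_iff Re_exp)
  have "Complex 0 (- \<phi>) = - Complex 0 \<phi>" by (simp add: complex_eq_iff)
  then have "exp (Complex 0 (- \<phi>)) = inverse (exp (Complex 0 \<phi>))"
    by (simp add: exp_minus)
  moreover have "inverse (z - 1) + inverse (inverse z - 1) = - 1" if "z \<noteq> 0" "z \<noteq> 1" for z :: complex
  proof -
    have "inverse z - 1 = - ((z - 1) / z)" using that by (simp add: field_simps)
    then have "inverse (inverse z - 1) = - (z / (z - 1))"
      by (simp only: inverse_minus_eq inverse_divide)
    moreover have "inverse (z - 1) - z / (z - 1) = - 1"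
      using that by (simp add: divide_simps)
    ultimately show ?thesis by simp
  qed
  ultimately show "kern 0 \<phi> + kern 0 (- \<phi>) = - 1"
    using ne by (simp add: kern_def)
qed

text \<open>The pairing is compared with the explicit function \<open>\<Phi>\<close>, whose derivative dominates because
  \<open>exp (\<sigma> / 4) / sqrt (exp (2 * \<sigma>) - 1) \<le> 1 / sqrt (exp \<sigma> - 1)\<close>. As this is integrable at \<open>0\<close>,
  the bound does not depend on \<open>\<delta>\<close>.\<close>

lemma kern_pairing_bound:
  fixes k ks kp :: "real \<Rightarrow> real \<Rightarrow> complex"
  assumes \<delta>: "0 < \<delta>" "\<delta> < l"
    and ks: "\<And>\<sigma> \<phi>. \<sigma> \<in> {0..l} \<Longrightarrow> \<phi> \<in> {-pi..pi} \<Longrightarrow>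
      ((\<lambda>\<sigma>. k \<sigma> \<phi>) has_vector_derivative ks \<sigma> \<phi>) (at \<sigma>)"
    and kp: "\<And>\<sigma> \<phi>. \<sigma> \<in> {0..l} \<Longrightarrow> \<phi> \<in> {-pi..pi} \<Longrightarrow>
      (k \<sigma> has_vector_derivative kp \<sigma> \<phi>) (at \<phi>)"
    and cont: "continuous_on ({0..l} \<times> {-pi..pi}) (\<lambda>(\<sigma>, \<phi>). k \<sigma> \<phi>)"
      "continuous_on ({0..l} \<times> {-pi..pi}) (\<lambda>(\<sigma>, \<phi>). ks \<sigma> \<phi>)"
      "continuous_on ({0..l} \<times> {-pi..pi}) (\<lambda>(\<sigma>, \<phi>). kp \<sigma> \<phi>)"
    and Q: "\<And>\<sigma> \<phi>. \<sigma> \<in> {0..l} \<Longrightarrow> \<phi> \<in> {-pi..pi} \<Longrightarrow>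
      cmod (ks \<sigma> \<phi> + \<i> * kp \<sigma> \<phi>) \<le> Q * exp (\<sigma> / 4)"
    and D: "\<And>\<sigma>. \<sigma> \<in> {0..l} \<Longrightarrow> cmod (k \<sigma> pi - k \<sigma> (- pi)) \<le> D * exp (\<sigma> / 6)"
    and QD: "0 \<le> Q" "0 \<le> D"
  shows "cmod (integral {-pi..pi} (\<lambda>\<phi>. k \<delta> \<phi> * kern \<delta> \<phi>)) \<le>
    cmod (integral {-pi..pi} (\<lambda>\<phi>. k l \<phi> * kern l \<phi>)) + 2 * pi\<^sup>2 * Q + 6 / 5 * D"
proof -
  define J where "J = (\<lambda>\<sigma>. integral {-pi..pi} (\<lambda>\<phi>. k \<sigma> \<phi> * kern \<sigma> \<phi>))"
  define J' where "J' = (\<lambda>\<sigma>. integral {-pi..pi}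
    (\<lambda>\<phi>. ks \<sigma> \<phi> * kern \<sigma> \<phi> - k \<sigma> \<phi> * (exp (Complex \<sigma> \<phi>) * (kern \<sigma> \<phi>)\<^sup>2)))"
  \<comment> \<open>\<open>arctan (sqrt (exp \<sigma> - 1))\<close> has derivative 1 / (2 sqrt (exp
    \<sigma> - 1)) and stays below \<pi> / 2, whence 2 \<pi>^2 Q. The rate -5/6 = 1/6 - 1 combines
    the growth of the jump with the decay of the kernel on the slit.\<close>
  define \<Phi> where "\<Phi> = (\<lambda>\<sigma>. 4 * pi * Q * arctan (sqrt (exp \<sigma> - 1)) - 6 / 5 * D * exp (- (5 / 6) * \<sigma>))"
  have contk: "continuous_on {-pi..pi} (k \<sigma>)" "continuous_on {-pi..pi} (ks \<sigma>)"
      "continuous_on {-pi..pi} (kp \<sigma>)" if "\<sigma> \<in> {0..l}" for \<sigma>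
    by (rule continuous_on_uncurry[OF cont(1)] continuous_on_uncurry[OF cont(2)]
        continuous_on_uncurry[OF cont(3)]; use that in \<open>auto intro: continuous_intros\<close>)+
  have J_deriv: "(J has_vector_derivative J' \<sigma>) (at \<sigma> within {\<delta>..l})" if "\<sigma> \<in> {\<delta>..l}" for \<sigma>
    unfolding J_def J'_def interval_cbox[of "-pi" pi]
  proof (rule leibniz_rule_vector_derivative)
    fix \<sigma> \<phi> assume s: "\<sigma> \<in> {\<delta>..l}" and p: "\<phi> \<in> cbox (- pi) pi"
    from s \<delta> have s': "\<sigma> > 0" "\<sigma> \<in> {0..l}" by auto
    show "((\<lambda>\<sigma>. k \<sigma> \<phi> * kern \<sigma> \<phi>) has_vector_derivative
        ks \<sigma> \<phi> * kern \<sigma> \<phi> - k \<sigma> \<phi> * (exp (Complex \<sigma> \<phi>) * (kern \<sigma> \<phi>)\<^sup>2)) (at \<sigma> within {\<delta>..l})"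
      using p s'
      by (auto intro!: derivative_eq_intros kern_has_vector_derivative
          has_vector_derivative_at_within[OF ks])
  next
    fix \<sigma> assume s: "\<sigma> \<in> {\<delta>..l}"
    then show "(\<lambda>\<phi>. k \<sigma> \<phi> * kern \<sigma> \<phi>) integrable_on cbox (- pi) pi"
      using \<delta> contk by (intro integrable_continuous continuous_intros) auto
  next
    have 1: "continuous_on ({\<delta>..l} \<times> cbox (- pi) pi) (\<lambda>x. k (fst x) (snd x))"
      "continuous_on ({\<delta>..l} \<times> cbox (- pi) pi) (\<lambda>x. ks (fst x) (snd x))"
      using \<delta> by (auto intro!: continuous_on_subset[OF cont(1)[unfolded split_beta]]
          continuous_on_subset[OF cont(2)[unfolded split_beta]])
    show "continuous_on ({\<delta>..l} \<times> cbox (- pi) pi) (\<lambda>(\<sigma>, \<phi>).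
        ks \<sigma> \<phi> * kern \<sigma> \<phi> - k \<sigma> \<phi> * (exp (Complex \<sigma> \<phi>) * (kern \<sigma> \<phi>)\<^sup>2))"
      unfolding split_beta Complex_eq using \<delta>
      by (intro continuous_intros 1) auto
  qed (use that in auto)
  have J'_bound: "cmod (J' \<sigma>) \<le> Q * exp (\<sigma> / 4) * (2 * pi / sqrt (exp (2 * \<sigma>) - 1))
      + D * exp (\<sigma> / 6) * (1 / (exp \<sigma> + 1))" if "\<sigma> \<in> {\<delta>..l}" for \<sigma>
  proof -
    from that \<delta> have s: "\<sigma> > 0" "\<sigma> \<in> {0..l}" by auto
    \<comment> \<open>\<open>E\<close> is the \<phi>-derivative of
      \<open>k \<sigma> \<phi> * kern \<sigma> \<phi>\<close>. The kernel is holomorphic, so its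
      \<sigma>-derivative is -i times its \<phi>-derivative, and the integrand of \<open>J'\<close>
      becomes \<open>G - \<i> * E\<close>. Here \<open>G\<close> involves only the d-bar derivative
      of \<open>k\<close>, and \<open>E\<close> integrates to the jump across the slit.\<close>
    define E where "E = (\<lambda>\<phi>. kp \<sigma> \<phi> * kern \<sigma> \<phi> - k \<sigma> \<phi> * (\<i> * exp (Complex \<sigma> \<phi>) * (kern \<sigma> \<phi>)\<^sup>2))"
    have "(E has_integral k \<sigma> pi * kern \<sigma> pi - k \<sigma> (- pi) * kern \<sigma> (- pi)) {-pi..pi}"
      unfolding E_def using s
      by (intro fundamental_theorem_of_calculus)
        (auto intro!: derivative_eq_intros kern_has_vector_derivative
          has_vector_derivative_at_within[OF kp])
    then have E: "(E has_integral (k \<sigma> pi - k \<sigma> (- pi)) * kern \<sigma> pi) {-pi..pi}"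
      by (simp add: kern_pi_eq algebra_simps)
    define G where "G = (\<lambda>\<phi>. (ks \<sigma> \<phi> + \<i> * kp \<sigma> \<phi>) * kern \<sigma> \<phi>)"
    have Gint: "G integrable_on {-pi..pi}"
      unfolding G_def using s contk
      by (intro integrable_continuous_real continuous_intros) auto
    have "J' \<sigma> = integral {-pi..pi} (\<lambda>\<phi>. G \<phi> - \<i> * E \<phi>)"
      unfolding J'_def by (intro integral_cong) (simp add: G_def E_def algebra_simps)
    also have "\<dots> = integral {-pi..pi} G - \<i> * integral {-pi..pi} E"
      using E Gint by (subst integral_diff) (auto simp: has_integral_integrable)
    also have "integral {-pi..pi} E = (k \<sigma> pi - k \<sigma> (- pi)) * kern \<sigma> pi"
      using E by (rule integral_unique)
    finally have "cmod (J' \<sigma>) \<le> cmod (integral {-pi..pi} G) +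
        cmod (k \<sigma> pi - k \<sigma> (- pi)) * cmod (kern \<sigma> pi)"
      using norm_triangle_ineq4[of "integral {-pi..pi} G" "\<i> * ((k \<sigma> pi - k \<sigma> (- pi)) * kern \<sigma> pi)"]
      by (simp add: norm_mult)
    also have "cmod (integral {-pi..pi} G) \<le>
        integral {-pi..pi} (\<lambda>\<phi>. Q * exp (\<sigma> / 4) * cmod (kern \<sigma> \<phi>))"
      unfolding G_def using Gint s Q
      by (intro integral_norm_bound_integral)
        (auto simp: G_def norm_mult intro!: integrable_continuous_real continuous_intros mult_right_mono)
    also have "\<dots> = Q * exp (\<sigma> / 4) * integral {-pi..pi} (\<lambda>\<phi>. cmod (kern \<sigma> \<phi>))"
      by simp
    also have "\<dots> \<le> Q * exp (\<sigma> / 4) * (2 * pi / sqrt (exp (2 * \<sigma>) - 1))"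
      using integral_norm_kern_le[OF s(1)] QD by (intro mult_left_mono) auto
    also have "cmod (k \<sigma> pi - k \<sigma> (- pi)) * cmod (kern \<sigma> pi) \<le> D * exp (\<sigma> / 6) * (1 / (exp \<sigma> + 1))"
      unfolding norm_kern_pi using D[OF s(2)] QD
      by (intro mult_right_mono) (auto simp: add_nonneg_nonneg)
    finally show ?thesis by simp
  qed
  define \<Phi>' where "\<Phi>' = (\<lambda>\<sigma>. 2 * pi * Q / sqrt (exp \<sigma> - 1) + D * exp (- (5 / 6) * \<sigma>))"
  have \<Phi>_deriv: "(\<Phi> has_real_derivative \<Phi>' \<sigma>) (at \<sigma>)" if "\<sigma> > 0" for \<sigma>
  proof -
    have "exp \<sigma> - 1 > 0" using that by simp
    then show ?thesis
      unfolding \<Phi>_def \<Phi>'_def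
      by (auto intro!: derivative_eq_intros simp: divide_simps) 
  qed
  have \<Phi>'_ge: "Q * exp (\<sigma> / 4) * (2 * pi / sqrt (exp (2 * \<sigma>) - 1))
      + D * exp (\<sigma> / 6) * (1 / (exp \<sigma> + 1)) \<le> \<Phi>' \<sigma>" if "\<sigma> > 0" for \<sigma>
  proof -
    have e1: "exp \<sigma> > 1" using that by simp
    have "exp (\<sigma> / 4) / sqrt (exp (2 * \<sigma>) - 1) \<le> 1 / sqrt (exp \<sigma> - 1)"
    proof -
      have "exp (\<sigma>/4) * sqrt (exp \<sigma> - 1) = sqrt (exp (\<sigma>/2) * (exp \<sigma> - 1))"
      proof -
        have "exp (\<sigma>/2) = (exp (\<sigma>/4))\<^sup>2" by (simp flip: exp_double)
        then show ?thesis by (simp add: real_sqrt_mult)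
      qed
      also have "\<dots> \<le> sqrt (exp (2 * \<sigma>) - 1)"
      proof -
        have "exp (\<sigma>/2) * (exp \<sigma> - 1) \<le> (exp \<sigma> + 1) * (exp \<sigma> - 1)"
          using that e1 by (intro mult_right_mono) (auto intro: order_trans[of _ "exp \<sigma>"])
        also have "\<dots> = exp (2 * \<sigma>) - 1"
          unfolding exp_double by (simp add: power2_eq_square algebra_simps)
        finally show ?thesis by simp
      qed
      finally show ?thesis using that e1 by (simp add: field_simps)
    qed
    then have "2 * pi * Q * (exp (\<sigma> / 4) / sqrt (exp (2 * \<sigma>) - 1)) \<le> 2 * pi * Q * (1 / sqrt (exp \<sigma> - 1))"
      using QD by (intro mult_left_mono) auto
    moreover have "D * exp (\<sigma> / 6) * (1 / (exp \<sigma> + 1)) \<le> D * exp (\<sigma> / 6) * exp (- \<sigma>)"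
      using QD by (intro mult_left_mono) (auto simp: exp_minus field_simps add_pos_pos)
    moreover have "D * exp (\<sigma> / 6) * exp (- \<sigma>) = D * exp (- (5 / 6) * \<sigma>)"
      by (simp add: mult.assoc flip: exp_add)
    ultimately have "2 * pi * Q * (exp (\<sigma> / 4) / sqrt (exp (2 * \<sigma>) - 1)) +
        D * exp (\<sigma> / 6) * (1 / (exp \<sigma> + 1)) \<le> 2 * pi * Q * (1 / sqrt (exp \<sigma> - 1)) + D * exp (- (5 / 6) * \<sigma>)"
      by linarith
    then show ?thesis by (simp add: \<Phi>'_def mult_ac)
  qed
  have "cmod (J l - J \<delta>) \<le> \<Phi> l - \<Phi> \<delta>"
  proof (rule differentiable_bound_general[OF \<delta>(2)])
    show "continuous_on {\<delta>..l} J"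
      using J_deriv has_vector_derivative_continuous
      unfolding continuous_on_eq_continuous_within by blast
    show "continuous_on {\<delta>..l} \<Phi>"
      using \<delta>(1) by (intro DERIV_atLeastAtMost_imp_continuous_on) (meson \<Phi>_deriv less_le_trans)
  next
    fix \<sigma> assume s: "\<delta> < \<sigma>" "\<sigma> < l"
    show "(J has_vector_derivative J' \<sigma>) (at \<sigma>)"
      using J_deriv[of \<sigma>] s at_within_Icc_at[of \<delta> \<sigma> l] by simp
    show "(\<Phi> has_vector_derivative \<Phi>' \<sigma>) (at \<sigma>)"
      using \<Phi>_deriv[of \<sigma>] s \<delta> by (simp add: has_real_derivative_iff_has_vector_derivative)
    show "cmod (J' \<sigma>) \<le> \<Phi>' \<sigma>"
      using J'_bound[of \<sigma>] \<Phi>'_ge[of \<sigma>] s \<delta> by auto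
  qed
  also have "\<Phi> l - \<Phi> \<delta> \<le> 4 * pi * Q * (pi / 2) + 6 / 5 * D"
  proof -
    have "4 * pi * Q * arctan (sqrt (exp l - 1)) \<le> 4 * pi * Q * (pi / 2)"
      using QD arctan_ubound less_imp_le by (intro mult_left_mono) auto
    moreover have "0 \<le> 4 * pi * Q * arctan (sqrt (exp \<delta> - 1))"
      using QD \<delta> by auto
    moreover have "6 / 5 * D * exp (- (5 / 6) * \<delta>) \<le> 6 / 5 * D * 1"
      using QD \<delta> by (intro mult_left_mono) auto
    moreover have "0 \<le> 6 / 5 * D * exp (- (5 / 6) * l)" using QD by auto
    ultimately show ?thesis unfolding \<Phi>_def by linarith
  qed
  also have "4 * pi * Q * (pi / 2) = 2 * pi\<^sup>2 * Q" by (simp add: power2_eq_square)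
  finally have "cmod (J l - J \<delta>) \<le> 2 * pi\<^sup>2 * Q + 6 / 5 * D" .
  then show ?thesis unfolding J_def[symmetric]
    using norm_triangle_ineq2[of "J \<delta>" "J l"] by (simp add: J_def norm_minus_commute)
qed

lemma vector_differentiable_bound:
  fixes f :: "real \<Rightarrow> 'a::real_normed_vector"
  assumes "\<And>x. x \<in> S \<Longrightarrow> (f has_vector_derivative f' x) (at x within S)"
    and "\<And>x. x \<in> S \<Longrightarrow> norm (f' x) \<le> B" and "convex S" "x \<in> S" "y \<in> S"
  shows "norm (f x - f y) \<le> B * \<bar>x - y\<bar>"
proof -
  have "onorm (\<lambda>h. h *\<^sub>R f' z) \<le> B" if "z \<in> S" for z
    using assms(2)[OF that] by (intro onorm_le) (auto simp: mult.commute[of B] intro: mult_left_mono)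
  then show ?thesis
    using differentiable_bound[OF assms(3), of f "\<lambda>x h. h *\<^sub>R f' x" B x y] assms
    by (simp add: has_vector_derivative_def mult.commute)
qed

text \<open>Subtracting \<open>h s0 t0\<close> costs nothing as \<open>kern \<delta>\<close> has mean zero, and makes the integrands
  bounded. The limit \<open>kern 0\<close> of the kernel has the symmetric part \<open>- 1/2\<close>, whence the mean of \<open>h s0\<close>.\<close>

lemma kern_pairing_jump:
  fixes h :: "real \<Rightarrow> real \<Rightarrow> complex"
  assumes r: "0 < r"
    and cont: "continuous_on ({s0 - r..s0 + r} \<times> {t0 - pi..t0 + pi}) (\<lambda>(s, t). h s t)"
    and lip: "\<And>s t. s \<in> {s0 - r..s0 + r} \<Longrightarrow> t \<in> {t0 - pi..t0 + pi} \<Longrightarrow>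
      cmod (h s t - h s0 t0) \<le> M * (\<bar>s - s0\<bar> + \<bar>t - t0\<bar>)"
    and B: "\<And>\<delta>. 0 < \<delta> \<Longrightarrow> \<delta> < r \<Longrightarrow>
      cmod (integral {-pi..pi} (\<lambda>\<phi>. h (s0 + \<delta>) (t0 + \<phi>) * kern \<delta> \<phi>)) \<le> B1"
      "\<And>\<delta>. 0 < \<delta> \<Longrightarrow> \<delta> < r \<Longrightarrow>
      cmod (integral {-pi..pi} (\<lambda>\<phi>. h (s0 - \<delta>) (t0 - \<phi>) * kern \<delta> \<phi>)) \<le> B2"
  shows "cmod (2 * of_real pi * h s0 t0 - integral {-pi..pi} (\<lambda>\<phi>. h s0 (t0 + \<phi>))) \<le> B1 + B2"
proof -
  define h0 where "h0 = h s0 t0"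
  \<comment> \<open>The shift by 2 keeps every \<delta> n strictly between 0 and r, the range in
    which the bounds \<open>B\<close> are available.\<close>
  define \<delta> where "\<delta> = (\<lambda>n. r / of_nat (n + 2))"
  have \<delta>: "0 < \<delta> n" "\<delta> n < r" for n
    using r by (auto simp: \<delta>_def field_simps add_pos_nonneg)
  have \<delta>_lim: "\<delta> \<longlonglongrightarrow> 0" 
    unfolding \<delta>_def by (rule LIMSEQ_ignore_initial_segment[OF lim_const_over_n])
  \<comment> \<open>The two sides of the pole are combined at points symmetric about (s0, t0), so
    \<open>h0\<close> is subtracted once for each side and \<open>e 0\<close> is even.\<close>
  define e where "e = (\<lambda>d \<phi>. (h (s0 + d) (t0 + \<phi>) - h0) + (h (s0 - d) (t0 - \<phi>) - h0))"
  \<comment> \<open>The value at \<phi> = 0 is changed to 0, which does not affect the integral: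
    there the Lipschitz bound gives boundedness of the product but no limit.\<close>
  define f where "f = (\<lambda>n \<phi>. if \<phi> = 0 then 0 else e (\<delta> n) \<phi> * kern (\<delta> n) \<phi>)"
  define g where "g = (\<lambda>\<phi>. if \<phi> = 0 then 0 else e 0 \<phi> * kern 0 \<phi>)"
  have contp: "continuous_on {-pi..pi} (\<lambda>\<phi>. h (s0 + d) (t0 + \<phi>))"
    "continuous_on {-pi..pi} (\<lambda>\<phi>. h (s0 + d) (t0 - \<phi>))" if "\<bar>d\<bar> \<le> r" for d
    by (rule continuous_on_uncurry[OF cont]; use that in \<open>auto intro!: continuous_intros\<close>)+
  have contm: "continuous_on {-pi..pi} (\<lambda>\<phi>. h (s0 - d) (t0 - \<phi>))" if "\<bar>d\<bar> \<le> r" for d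
    using contp(2)[of "- d"] that by simp
  have conte: "continuous_on {-pi..pi} (e d)" if "\<bar>d\<bar> \<le> r" for d
    unfolding e_def using that by (intro continuous_intros contp contm)
  have e_le: "cmod (e d \<phi>) \<le> 2 * M * (d + \<bar>\<phi>\<bar>)" if "0 \<le> d" "d \<le> r" "\<phi> \<in> {-pi..pi}" for d \<phi>
  proof -
    have "cmod (h (s0 + d) (t0 + \<phi>) - h0) \<le> M * (d + \<bar>\<phi>\<bar>)"
      "cmod (h (s0 - d) (t0 - \<phi>) - h0) \<le> M * (d + \<bar>\<phi>\<bar>)"
      using lip[of "s0 + d" "t0 + \<phi>"] lip[of "s0 - d" "t0 - \<phi>"] that by (auto simp: h0_def)
    then show ?thesis unfolding e_def by (intro order_trans[OF norm_triangle_ineq]) linarith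
  qed
  have "0 \<le> M * (r + pi)" using lip[of "s0 + r" "t0 + pi"] r pi_gt_zero
    by (intro order_trans[OF norm_ge_zero]) auto
  then have M: "0 \<le> M" using r pi_gt_zero by (simp add: zero_le_mult_iff)
  have ek_int: "(\<lambda>\<phi>. e (\<delta> n) \<phi> * kern (\<delta> n) \<phi>) integrable_on {-pi..pi}" for n
    using \<delta>[of n] by (intro integrable_continuous_real continuous_intros conte) auto
  have f_int: "f n integrable_on {-pi..pi}" for n
    by (rule integrable_spike_finite[OF _ _ ek_int[of n], of "{0}"]) (auto simp: f_def)
  have f_integral: "integral {-pi..pi} (f n) =
      integral {-pi..pi} (\<lambda>\<phi>. h (s0 + \<delta> n) (t0 + \<phi>) * kern (\<delta> n) \<phi>) +
      integral {-pi..pi} (\<lambda>\<phi>. h (s0 - \<delta> n) (t0 - \<phi>) * kern (\<delta> n) \<phi>)" for n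
  proof -
    have k: "(kern (\<delta> n) has_integral 0) {-pi..pi}" by (rule kern_has_integral_0[OF \<delta>(1)])
    have 1: "(\<lambda>\<phi>. h (s0 + \<delta> n) (t0 + \<phi>) * kern (\<delta> n) \<phi>) integrable_on {-pi..pi}"
      "(\<lambda>\<phi>. h (s0 - \<delta> n) (t0 - \<phi>) * kern (\<delta> n) \<phi>) integrable_on {-pi..pi}"
      using \<delta>[of n] by (auto intro!: integrable_continuous_real continuous_intros contp contm)
    have "integral {-pi..pi} (f n) = integral {-pi..pi} (\<lambda>\<phi>. e (\<delta> n) \<phi> * kern (\<delta> n) \<phi>)"
      by (rule integral_spike[of "{0}"]) (auto simp: f_def)
    also have "\<dots> = integral {-pi..pi} (\<lambda>\<phi>. h (s0 + \<delta> n) (t0 + \<phi>) * kern (\<delta> n) \<phi> +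
       h (s0 - \<delta> n) (t0 - \<phi>) * kern (\<delta> n) \<phi> - 2 * h0 * kern (\<delta> n) \<phi>)"
      by (intro integral_cong) (simp add: e_def algebra_simps)
    also have "\<dots> = integral {-pi..pi} (\<lambda>\<phi>. h (s0 + \<delta> n) (t0 + \<phi>) * kern (\<delta> n) \<phi>) +
      integral {-pi..pi} (\<lambda>\<phi>. h (s0 - \<delta> n) (t0 - \<phi>) * kern (\<delta> n) \<phi>) -
      2 * h0 * integral {-pi..pi} (kern (\<delta> n))"
      using 1 k
      by (simp add: integral_diff integral_add integrable_add has_integral_integrable
          integrable_on_mult_right)
    finally show ?thesis using k by (simp add: integral_unique)
  qed
  have f_le: "cmod (f n \<phi>) \<le> 8 * M" if "\<phi> \<in> {-pi..pi}" for n \<phi>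
  proof (cases "\<phi> = 0")
    case False
    have "cmod (f n \<phi>) \<le> 2 * M * (\<delta> n + \<bar>\<phi>\<bar>) * cmod (kern (\<delta> n) \<phi>)"
      using False e_le[of "\<delta> n" \<phi>] \<delta>[of n] that
      by (simp add: f_def norm_mult mult_right_mono)
    also have "\<dots> = 2 * M * (cmod (kern (\<delta> n) \<phi>) * (\<delta> n + \<bar>\<phi>\<bar>))" by simp
    also have "\<dots> \<le> 2 * M * 4"
      using M \<delta>[of n] that by (intro mult_left_mono norm_kern_mult_le) auto
    finally show ?thesis by simp
  qed (use M in \<open>simp add: f_def\<close>)
  have f_lim: "(\<lambda>n. f n \<phi>) \<longlonglongrightarrow> g \<phi>" if p: "\<phi> \<in> {-pi..pi}" for \<phi>
  proof (cases "\<phi> = 0")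
    case False
    have c: "continuous_on {s0 - r..s0 + r} (\<lambda>s. h s t)" if "t \<in> {t0 - pi..t0 + pi}" for t
      by (rule continuous_on_uncurry[OF cont]; use that in \<open>auto intro!: continuous_intros\<close>)
    have box: "- r \<le> \<delta> n" "- \<delta> n \<le> r" "\<delta> n \<le> r" for n using \<delta>[of n] r by auto
    have 1: "(\<lambda>n. h (s0 + \<delta> n) (t0 + \<phi>)) \<longlonglongrightarrow> h s0 (t0 + \<phi>)"
      by (rule continuous_on_tendsto_compose[OF c])
        (use p r box \<delta>_lim in \<open>auto intro!: tendsto_eq_intros always_eventually\<close>)
    have 2: "(\<lambda>n. h (s0 - \<delta> n) (t0 - \<phi>)) \<longlonglongrightarrow> h s0 (t0 - \<phi>)"
      by (rule continuous_on_tendsto_compose[OF c])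
        (use p r box \<delta>_lim in \<open>auto intro!: tendsto_eq_intros always_eventually\<close>)
    have "(\<lambda>n. Complex (\<delta> n) \<phi>) \<longlonglongrightarrow> Complex 0 \<phi>"
      using \<delta>_lim by (intro tendsto_intros)
    then have 3: "(\<lambda>n. kern (\<delta> n) \<phi>) \<longlonglongrightarrow> kern 0 \<phi>"
      unfolding kern_def using kern_imaginary_add(2)[of \<phi>] False p
      by (intro tendsto_inverse tendsto_diff tendsto_exp tendsto_const) (auto simp: abs_le_iff)
    show ?thesis
      using False 1 2 3 by (auto simp: f_def g_def e_def intro!: tendsto_intros)
  qed (simp add: f_def g_def)
  have dct: "g integrable_on {-pi..pi}" "(\<lambda>n. integral {-pi..pi} (f n)) \<longlonglongrightarrow> integral {-pi..pi} g"
    by (rule dominated_convergence[where f = f and h = "\<lambda>_. 8 * M"]; use f_int f_le f_lim in auto)+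
  define A where "A = integral {-pi..pi} (\<lambda>\<phi>. h s0 (t0 + \<phi>))"
  have A: "((\<lambda>\<phi>. h s0 (t0 + \<phi>)) has_integral A) {-pi..pi}"
    unfolding A_def using contp(1)[of 0] r by (intro integrable_integral integrable_continuous_real) auto
  then have A': "((\<lambda>\<phi>. h s0 (t0 - \<phi>)) has_integral A) {-pi..pi}"
    using has_integral_reflect_real[of "\<lambda>\<phi>. h s0 (t0 + \<phi>)" A pi "-pi"] by simp
  have c: "((\<lambda>_. 2 * h0) has_integral 4 * of_real pi * h0) {-pi..pi}"
    using has_integral_const_real[of "2 * h0" "-pi" pi] by (simp add: scaleR_conv_of_real mult.assoc)
  have E: "((\<lambda>\<phi>. - e 0 \<phi>) has_integral (4 * of_real pi * h0 - (A + A))) {-pi..pi}"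
    using has_integral_diff[OF c has_integral_add[OF A A']] 
    by (simp add: e_def algebra_simps)
  have G: "(g has_integral integral {-pi..pi} g) {-pi..pi}"
    using dct(1) by (rule integrable_integral)
  then have G': "((\<lambda>\<phi>. g (- \<phi>)) has_integral integral {-pi..pi} g) {-pi..pi}"
    using has_integral_reflect_real[of g _ pi "-pi"] by simp
  \<comment> \<open>Adding the reflection of \<open>g\<close> removes the kernel, as
    \<open>e 0\<close> is even and the two kernel values sum to -1. Comparison with \<open>E\<close>
    then evaluates twice the integral of \<open>g\<close>.\<close>
  have "((\<lambda>\<phi>. - e 0 \<phi>) has_integral integral {-pi..pi} g + integral {-pi..pi} g) {-pi..pi}"
  proof (rule has_integral_spike_finite[of "{0}", OF _ _ has_integral_add[OF G G']])
    fix \<phi> assume p: "\<phi> \<in> {-pi..pi} - {0}"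
    have "e 0 (- \<phi>) = e 0 \<phi>" by (simp add: e_def)
    then have "g \<phi> + g (- \<phi>) = e 0 \<phi> * (kern 0 \<phi> + kern 0 (- \<phi>))"
      using p by (simp add: g_def algebra_simps)
    also have "kern 0 \<phi> + kern 0 (- \<phi>) = - 1" using p by (intro kern_imaginary_add) auto
    finally show "- e 0 \<phi> = g \<phi> + g (- \<phi>)" by simp
  qed auto
  from has_integral_unique[OF this E]
  have "2 * integral {-pi..pi} g = 2 * (2 * of_real pi * h0 - A)"
    by (simp add: algebra_simps)
  then have lim: "integral {-pi..pi} g = 2 * of_real pi * h0 - A"
    by (rule mult_left_cancel[THEN iffD1, rotated]) simp
  have "cmod (integral {-pi..pi} (f n)) \<le> B1 + B2" for n
    unfolding f_integral using B[of "\<delta> n"] \<delta>[of n]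
    by (intro order_trans[OF norm_triangle_ineq] add_mono) auto
  then have "cmod (integral {-pi..pi} g) \<le> B1 + B2"
    by (intro LIMSEQ_le_const2[OF tendsto_norm[OF dct(2)]]) auto
  then show ?thesis unfolding lim by (simp add: A_def h0_def)
qed

subsection \<open>The estimate on a strip\<close>

text \<open>At distance at least ln 2 from the pole sqrt (exp (2 l) - 1) is comparable to exp l, so
  the L^1 norm of the kernel decays like exp (- l). This controls the pairing at the far ends of the
  strip.\<close>

lemma norm_kern_pairing_le:
  assumes l: "ln 2 \<le> l" and cont: "continuous_on {-pi..pi} k"
    and B: "\<And>\<phi>. \<phi> \<in> {-pi..pi} \<Longrightarrow> cmod (k \<phi>) \<le> B"
  shows "cmod (integral {-pi..pi} (\<lambda>\<phi>. k \<phi> * kern l \<phi>)) \<le> 4 * pi * B * exp (- l)"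
proof -
  have l0: "l > 0" using l by (rule less_le_trans[rotated]) simp
  have "0 \<le> B" by (rule order_trans[OF norm_ge_zero B[of 0]]) auto
  have el: "2 \<le> exp l" using l by (metis exp_le_cancel_iff exp_ln zero_less_numeral)
  have "cmod (integral {-pi..pi} (\<lambda>\<phi>. k \<phi> * kern l \<phi>)) \<le>
      integral {-pi..pi} (\<lambda>\<phi>. B * cmod (kern l \<phi>))"
    using B l0 cont
    by (intro integral_norm_bound_integral)
      (auto simp: norm_mult intro!: integrable_continuous_real continuous_intros mult_right_mono)
  also have "\<dots> = B * integral {-pi..pi} (\<lambda>\<phi>. cmod (kern l \<phi>))" by simp
  also have "\<dots> \<le> B * (2 * pi / sqrt (exp (2 * l) - 1))"
    using integral_norm_kern_le[OF l0] \<open>0 \<le> B\<close> by (intro mult_left_mono)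
  also have "\<dots> \<le> B * (2 * pi / (exp l / 2))"
  proof -
    have "2 * 2 \<le> exp l * exp l" using el by (intro mult_mono) auto
    then have "(exp l / 2)\<^sup>2 \<le> exp (2 * l) - 1"
      unfolding exp_double by (simp add: power2_eq_square)
    then have "exp l / 2 \<le> sqrt (exp (2 * l) - 1)" by (rule real_le_rsqrt)
    then show ?thesis
      using \<open>0 \<le> B\<close> l0 by (intro mult_left_mono divide_left_mono mult_pos_pos) auto
  qed
  also have "\<dots> = 4 * pi * B * exp (- l)" by (simp add: exp_minus field_simps)
  finally show ?thesis .
qed

text \<open>The intended values are h = \<zeta> f, L = ln (sqrt R) and s1 = ln r1, with N a multiple
  of \<epsilon> |w(r1, 0)|. The factors |\<zeta>| and |\<zeta>|^2 turn the given exponents into 7/12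
  = 1 - 5/12 and -1/4 = 2 - 9/4. The growth rate 1/6 of the jump is a rational upper bound for 1 /
  (2 \<pi>), and the absolute value allows growth in both directions from s1.\<close>

locale log_strip =
  fixes h hs ht :: "real \<Rightarrow> real \<Rightarrow> complex" and L C N s1 :: real
  assumes hs: "\<And>s t. s \<in> {0..L} \<Longrightarrow> t \<in> {-pi..3 * pi} \<Longrightarrow>
      ((\<lambda>s. h s t) has_vector_derivative hs s t) (at s)"
    and ht: "\<And>s t. s \<in> {0..L} \<Longrightarrow> t \<in> {-pi..3 * pi} \<Longrightarrow>
      (h s has_vector_derivative ht s t) (at t)"
    and cont: "continuous_on ({0..L} \<times> {-pi..3 * pi}) (\<lambda>(s, t). h s t)"
      "continuous_on ({0..L} \<times> {-pi..3 * pi}) (\<lambda>(s, t). hs s t)"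
      "continuous_on ({0..L} \<times> {-pi..3 * pi}) (\<lambda>(s, t). ht s t)"
    and h_le: "\<And>s t. s \<in> {0..L} \<Longrightarrow> t \<in> {-pi..3 * pi} \<Longrightarrow> cmod (h s t) \<le> C * exp (7 / 12 * s)"
    and dbar_le: "\<And>s t. s \<in> {0..L} \<Longrightarrow> t \<in> {-pi..3 * pi} \<Longrightarrow>
      cmod (hs s t + \<i> * ht s t) \<le> C * exp (- s / 4)"
    and sep_le: "\<And>s t. s \<in> {0..L} \<Longrightarrow> t \<in> {-pi..pi} \<Longrightarrow>
      cmod (h s (t + 2 * pi) - h s t) \<le> N * exp (\<bar>s - s1\<bar> / 6)"
    and C: "0 \<le> C" and s1: "0 \<le> s1" "s1 \<le> L"
begin

lemma N_nonneg: "0 \<le> N"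
  using order_trans[OF norm_ge_zero sep_le[of s1 0]] s1 by simp

text \<open>On a circle \<zeta> d\<theta> = -i d\<zeta>, so this is -i times the integral of f
  d\<zeta> over the circle of radius exp s cut opposite to t0. For single valued holomorphic f it
  would be 2 \<pi> times a residue, independent of s and t0.\<close>

definition mean :: "real \<Rightarrow> real \<Rightarrow> complex" where
  "mean t0 s = integral {-pi..pi} (\<lambda>\<phi>. h s (t0 + \<phi>))"

lemma continuous_on_slice:
  assumes "t0 \<in> {0..2 * pi}" "s \<in> {0..L}"
  shows "continuous_on {-pi..pi} (\<lambda>\<phi>. h s (t0 + \<phi>))"
    "continuous_on {-pi..pi} (\<lambda>\<phi>. hs s (t0 + \<phi>))"
    "continuous_on {-pi..pi} (\<lambda>\<phi>. ht s (t0 + \<phi>))"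
  by (rule continuous_on_uncurry[OF cont(1)] continuous_on_uncurry[OF cont(2)]
      continuous_on_uncurry[OF cont(3)]; use assms in \<open>auto intro!: continuous_intros\<close>)+

lemma vector_derivative_slice:
  assumes "t \<in> {-pi..3 * pi}" "s \<in> {0..L}" "t = x + y"
  shows "((\<lambda>y. h s (x + y)) has_vector_derivative ht s t) (at y)"
    "((\<lambda>x. h s (x + y)) has_vector_derivative ht s t) (at x)"
proof -
  note * = ht[OF assms(2,1)]
  have "((\<lambda>y. x + y) has_vector_derivative 1) (at y)" "((\<lambda>x. x + y) has_vector_derivative 1) (at x)"
    by (auto intro!: derivative_eq_intros)
  from vector_diff_chain_at[OF this(1)] vector_diff_chain_at[OF this(2)] *
  show "((\<lambda>y. h s (x + y)) has_vector_derivative ht s t) (at y)"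
    "((\<lambda>x. h s (x + y)) has_vector_derivative ht s t) (at x)"
    by (auto simp: o_def assms(3))
qed

lemma ht_has_integral:
  assumes "t0 \<in> {0..2 * pi}" "s \<in> {0..L}"
  shows "((\<lambda>\<phi>. ht s (t0 + \<phi>)) has_integral h s (t0 + pi) - h s (t0 - pi)) {-pi..pi}"
proof -
  have "((\<lambda>\<phi>. h s (t0 + \<phi>)) has_vector_derivative ht s (t0 + \<phi>)) (at \<phi> within {-pi..pi})"
    if "\<phi> \<in> {-pi..pi}" for \<phi>
    using vector_derivative_slice(1)[of "t0 + \<phi>" s t0 \<phi>] that assms
    by (auto intro: has_vector_derivative_at_within)
  from fundamental_theorem_of_calculus[OF _ this] show ?thesis by simp
qed

lemma jump_le:
  assumes "t0 \<in> {0..2 * pi}" "s \<in> {0..L}"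
  shows "cmod (h s (t0 + pi) - h s (t0 - pi)) \<le> N * exp (\<bar>s - s1\<bar> / 6)"
  using sep_le[of s "t0 - pi"] assms by (simp add: algebra_simps)

text \<open>Under the integral, h_s is split as (h_s + i h_t) - i h_t. The first part is bounded
  through the Laplacian and the second integrates exactly to the jump across the slit.\<close>

lemma mean_deriv_radial:
  assumes t0: "t0 \<in> {0..2 * pi}" and s: "s \<in> {0..L}"
  shows "\<exists>d. (mean t0 has_vector_derivative d) (at s within {0..L}) \<and>
    cmod d \<le> 2 * pi * C * exp (- s / 4) + N * exp (\<bar>s - s1\<bar> / 6)"
proof -
  define d where "d = integral {-pi..pi} (\<lambda>\<phi>. hs s (t0 + \<phi>))"
  have deriv: "(mean t0 has_vector_derivative d) (at s within {0..L})"
    unfolding mean_def d_def interval_cbox[of "-pi" pi]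
  proof (rule leibniz_rule_vector_derivative)
    fix s \<phi> assume "s \<in> {0..L}" "\<phi> \<in> cbox (- pi) pi"
    then show "((\<lambda>s. h s (t0 + \<phi>)) has_vector_derivative hs s (t0 + \<phi>)) (at s within {0..L})"
      using t0 by (intro has_vector_derivative_at_within[OF hs]) auto
  next
    fix s assume "s \<in> {0..L}"
    then show "(\<lambda>\<phi>. h s (t0 + \<phi>)) integrable_on cbox (- pi) pi"
      using continuous_on_slice[OF t0] by (auto intro: integrable_continuous_real)
  next
    show "continuous_on ({0..L} \<times> cbox (- pi) pi) (\<lambda>(s, \<phi>). hs s (t0 + \<phi>))"
      unfolding split_beta
      by (rule continuous_on_uncurry[OF cont(2)]; use t0 in \<open>auto intro!: continuous_intros\<close>)
  qed (use s in auto)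
  define G where "G = (\<lambda>\<phi>. hs s (t0 + \<phi>) + \<i> * ht s (t0 + \<phi>))"
  have G: "G integrable_on {-pi..pi}"
    unfolding G_def using continuous_on_slice[OF t0 s]
    by (intro integrable_continuous_real continuous_intros)
  have "d = integral {-pi..pi} (\<lambda>\<phi>. G \<phi> - \<i> * ht s (t0 + \<phi>))"
    unfolding d_def by (intro integral_cong) (simp add: G_def)
  also have "\<dots> = integral {-pi..pi} G - \<i> * (h s (t0 + pi) - h s (t0 - pi))"
    using has_integral_diff[OF integrable_integral[OF G] has_integral_mult_right[OF ht_has_integral[OF t0 s]]]
    by (rule integral_unique)
  finally have "cmod d \<le> cmod (integral {-pi..pi} G) + cmod (h s (t0 + pi) - h s (t0 - pi))"
    using norm_triangle_ineq4[of "integral {-pi..pi} G" "\<i> * (h s (t0 + pi) - h s (t0 - pi))"]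
    by (simp add: norm_mult)
  also have "\<dots> \<le> 2 * pi * C * exp (- s / 4) + N * exp (\<bar>s - s1\<bar> / 6)"
  proof (intro add_mono jump_le t0 s)
    have "cmod (integral {-pi..pi} G) \<le> integral {-pi..pi} (\<lambda>_. C * exp (- s / 4))"
      using G dbar_le[OF s] t0 by (intro integral_norm_bound_integral) (auto simp: G_def)
    then show "cmod (integral {-pi..pi} G) \<le> 2 * pi * C * exp (- s / 4)" by (simp add: mult_ac)
  qed
  finally show ?thesis using deriv by blast
qed

text \<open>The Laplacian contribution is integrable up to infinity and hence costs only its tail
  from s1, while the jump contribution grows at the rate 1/6.\<close>

lemma mean_radial:
  assumes t0: "t0 \<in> {0..2 * pi}" and s: "s1 < s" "s \<le> L"
  shows "cmod (mean t0 s - mean t0 s1) \<le> 8 * pi * C * exp (- s1 / 4) + 6 * N * exp ((s - s1) / 6)"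
proof -
  obtain d where d: "\<And>x. x \<in> {0..L} \<Longrightarrow> (mean t0 has_vector_derivative d x) (at x within {0..L})"
    "\<And>x. x \<in> {0..L} \<Longrightarrow> cmod (d x) \<le> 2 * pi * C * exp (- x / 4) + N * exp (\<bar>x - s1\<bar> / 6)"
    using mean_deriv_radial[OF t0] by metis
  \<comment> \<open>A primitive of the derivative bound: integrating exp (- x / 4) turns 2 \<pi>
    into 8 \<pi>, and integrating exp ((x - s1) / 6) produces the factor 6.\<close>
  define \<Phi> where "\<Phi> = (\<lambda>x. - (8 * pi * C * exp (- x / 4)) + 6 * N * exp ((x - s1) / 6))"
  define \<Phi>' where "\<Phi>' = (\<lambda>x. 2 * pi * C * exp (- x / 4) + N * exp ((x - s1) / 6))"
  have "cmod (mean t0 s - mean t0 s1) \<le> \<Phi> s - \<Phi> s1"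
  proof (rule differentiable_bound_general[OF s(1)])
    show "continuous_on {s1..s} \<Phi>" unfolding \<Phi>_def by (intro continuous_intros) auto
    have "continuous_on {0..L} (mean t0)"
      using d(1) has_vector_derivative_continuous unfolding continuous_on_eq_continuous_within by blast
    then show "continuous_on {s1..s} (mean t0)"
      using s s1 by (auto elim: continuous_on_subset)
  next
    fix x assume x: "s1 < x" "x < s"
    show "(mean t0 has_vector_derivative d x) (at x)"
      using d(1)[of x] x s s1 at_within_Icc_at[of 0 x L] by simp
    show "(\<Phi> has_vector_derivative \<Phi>' x) (at x)"
      unfolding \<Phi>_def \<Phi>'_def has_real_derivative_iff_has_vector_derivative[symmetric]
      by (auto intro!: derivative_eq_intros)
    show "cmod (d x) \<le> \<Phi>' x" using d(2)[of x] x s s1 by (simp add: \<Phi>'_def)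
  qed
  also have "\<dots> \<le> 8 * pi * C * exp (- s1 / 4) + 6 * N * exp ((s - s1) / 6)"
  proof -
    have "0 \<le> 8 * pi * C * exp (- s / 4)" using C by simp
    moreover have "\<Phi> s1 = - (8 * pi * C * exp (- s1 / 4)) + 6 * N" by (simp add: \<Phi>_def)
    ultimately show ?thesis using N_nonneg unfolding \<Phi>_def by linarith
  qed
  finally show ?thesis .
qed

text \<open>Rotating the slit changes the mean at a rate equal to the jump across it, at most N on
  the line s = s1. The reference angle \<pi> is the midpoint of the admissible angles, so the
  rotation is by at most \<pi>.\<close>

lemma mean_angular:
  assumes t0: "t0 \<in> {0..2 * pi}"
  shows "cmod (mean t0 s1 - mean pi s1) \<le> pi * N"
proof -
  have s: "s1 \<in> {0..L}" using s1 by simp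
  have "(((\<lambda>t. mean t s1)) has_vector_derivative (h s1 (t + pi) - h s1 (t - pi))) (at t within {0..2*pi})"
    if t: "t \<in> {0..2 * pi}" for t
  proof -
    have "((\<lambda>t. mean t s1) has_vector_derivative integral {-pi..pi} (\<lambda>\<phi>. ht s1 (t + \<phi>)))
        (at t within {0..2*pi})"
      unfolding mean_def interval_cbox[of "-pi" pi]
    proof (rule leibniz_rule_vector_derivative)
      fix t \<phi> assume "t \<in> {0..2 * pi}" "\<phi> \<in> cbox (- pi) pi"
      then show "((\<lambda>t. h s1 (t + \<phi>)) has_vector_derivative ht s1 (t + \<phi>)) (at t within {0..2 * pi})"
        using s by (intro has_vector_derivative_at_within[OF vector_derivative_slice(2)]) auto
    next
      fix t assume "t \<in> {0..2 * pi}"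
      then show "(\<lambda>\<phi>. h s1 (t + \<phi>)) integrable_on cbox (- pi) pi"
        using continuous_on_slice[OF _ s] by (auto intro: integrable_continuous_real)
    next
      show "continuous_on ({0..2 * pi} \<times> cbox (- pi) pi) (\<lambda>(t, \<phi>). ht s1 (t + \<phi>))"
        unfolding split_beta
        by (rule continuous_on_uncurry[OF cont(3)]; use s in \<open>auto intro!: continuous_intros\<close>)
    qed (use t in auto)
    then show ?thesis using integral_unique[OF ht_has_integral[OF t s]] by simp
  qed
  moreover have "cmod (h s1 (t + pi) - h s1 (t - pi)) \<le> N" if "t \<in> {0..2 * pi}" for t
    using jump_le[OF that s] by simp
  ultimately have "cmod (mean t0 s1 - mean pi s1) \<le> N * \<bar>t0 - pi\<bar>"
    by (intro vector_differentiable_bound[where S="{0..2 * pi}"]) (use t0 in auto)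
  also have "\<dots> \<le> N * pi" using t0 N_nonneg by (intro mult_left_mono) auto
  finally show ?thesis by (simp add: mult.commute)
qed

end

context log_strip
begin

text \<open>The jump relation at the pole compares 2 \<pi> h with \<open>mean t0 s0\<close>; the
  mean is then moved radially to s1 and its slit rotated to the reference position. In order, the
  terms come from the far ends s = L and s = 0, the Laplacian, the jumps on both sides of the pole,
  the radial move and the rotation.\<close>

lemma strip_estimate:
  assumes t0: "t0 \<in> {0..2 * pi}" and s0: "s1 + ln 2 \<le> s0" "s0 \<le> L - ln 2"
  shows "cmod (2 * of_real pi * h s0 t0 - mean pi s1) \<le>
    4 * pi * C * exp (s0 - 5 / 12 * L) + 4 * pi * C * exp (- s0) + 4 * pi\<^sup>2 * C * exp (- s0 / 4)
    + 12 / 5 * N * exp ((s0 - s1) / 6)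
    + (8 * pi * C * exp (- s1 / 4) + 6 * N * exp ((s0 - s1) / 6)) + pi * N"
proof -
  have ln2: "0 < ln (2::real)" by simp
  have s0_pos: "0 < s0" "s0 < L" "ln 2 \<le> s0" "ln 2 \<le> L - s0" "s1 < s0" using s0 s1 ln2 by linarith+
  \<comment> \<open>These serve both sides of the pole. At distance \<sigma> the Laplacian bound is
    exactly Q exp (\<sigma> / 4) to the left and smaller to the right, while the jump bound is
    exactly D exp (\<sigma> / 6) to the right and at most that to the left.\<close>
  define Q D where "Q = C * exp (- s0 / 4)" and "D = N * exp ((s0 - s1) / 6)"
  have QD: "0 \<le> Q" "0 \<le> D" using C N_nonneg by (simp_all add: Q_def D_def)
  have right: "cmod (integral {-pi..pi} (\<lambda>\<phi>. h (s0 + \<delta>) (t0 + \<phi>) * kern \<delta> \<phi>)) \<le>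
      4 * pi * C * exp (s0 - 5 / 12 * L) + 2 * pi\<^sup>2 * Q + 6 / 5 * D"
    if \<delta>: "0 < \<delta>" "\<delta> < ln 2" for \<delta>
  proof -
    have mem: "s0 + \<sigma> \<in> {0..L}" "t0 + \<phi> \<in> {-pi..3 * pi}"
      if "\<sigma> \<in> {0..L - s0}" "\<phi> \<in> {-pi..pi}" for \<sigma> \<phi>
      using that t0 s0_pos by auto
    have c: "continuous_on ({0..L - s0} \<times> {-pi..pi}) (\<lambda>x. h (s0 + fst x) (t0 + snd x))"
      "continuous_on ({0..L - s0} \<times> {-pi..pi}) (\<lambda>x. hs (s0 + fst x) (t0 + snd x))"
      "continuous_on ({0..L - s0} \<times> {-pi..pi}) (\<lambda>x. ht (s0 + fst x) (t0 + snd x))"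
      by (rule continuous_on_uncurry[OF cont(1)] continuous_on_uncurry[OF cont(2)]
          continuous_on_uncurry[OF cont(3)]; use mem in \<open>auto intro!: continuous_intros\<close>)+
    have "cmod (integral {-pi..pi} (\<lambda>\<phi>. h (s0 + \<delta>) (t0 + \<phi>) * kern \<delta> \<phi>)) \<le>
      cmod (integral {-pi..pi} (\<lambda>\<phi>. h (s0 + (L - s0)) (t0 + \<phi>) * kern (L - s0) \<phi>)) + 2 * pi\<^sup>2 * Q + 6 / 5 * D"
    proof (rule kern_pairing_bound[where k = "\<lambda>\<sigma> \<phi>. h (s0 + \<sigma>) (t0 + \<phi>)"
        and ks = "\<lambda>\<sigma> \<phi>. hs (s0 + \<sigma>) (t0 + \<phi>)" and kp = "\<lambda>\<sigma> \<phi>. ht (s0 + \<sigma>) (t0 + \<phi>)"])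
      fix \<sigma> \<phi> assume sp: "\<sigma> \<in> {0..L - s0}" "\<phi> \<in> {-pi..pi}"
      show "((\<lambda>\<sigma>. h (s0 + \<sigma>) (t0 + \<phi>)) has_vector_derivative hs (s0 + \<sigma>) (t0 + \<phi>)) (at \<sigma>)"
      proof -
        have "((\<lambda>\<sigma>. s0 + \<sigma>) has_vector_derivative 1) (at \<sigma>)" by (auto intro!: derivative_eq_intros)
        from vector_diff_chain_at[OF this hs[OF mem[OF sp]]] show ?thesis by (simp add: o_def)
      qed
      show "((\<lambda>\<phi>. h (s0 + \<sigma>) (t0 + \<phi>)) has_vector_derivative ht (s0 + \<sigma>) (t0 + \<phi>)) (at \<phi>)"
        using vector_derivative_slice(1) mem[OF sp] by blast
      have "cmod (hs (s0 + \<sigma>) (t0 + \<phi>) + \<i> * ht (s0 + \<sigma>) (t0 + \<phi>)) \<le> C * exp (- (s0 + \<sigma>) / 4)"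
        by (rule dbar_le[OF mem[OF sp]])
      also have "\<dots> \<le> C * exp (- s0 / 4 + \<sigma> / 4)"
        using sp C by (intro mult_left_mono) auto
      finally show "cmod (hs (s0 + \<sigma>) (t0 + \<phi>) + \<i> * ht (s0 + \<sigma>) (t0 + \<phi>)) \<le> Q * exp (\<sigma> / 4)"
        by (simp only: Q_def exp_add mult.assoc)
    next
      fix \<sigma> assume sp: "\<sigma> \<in> {0..L - s0}"
      have "cmod (h (s0 + \<sigma>) (t0 + pi) - h (s0 + \<sigma>) (t0 - pi)) \<le> N * exp (\<bar>s0 + \<sigma> - s1\<bar> / 6)"
        using sp s0_pos by (intro jump_le[OF t0]) auto
      also have "\<dots> \<le> N * exp ((s0 - s1) / 6 + \<sigma> / 6)"
        using sp s0_pos N_nonneg by (intro mult_left_mono) auto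
      finally show "cmod (h (s0 + \<sigma>) (t0 + pi) - h (s0 + \<sigma>) (t0 + - pi)) \<le> D * exp (\<sigma> / 6)"
        by (simp only: D_def exp_add mult.assoc diff_conv_add_uminus)
    qed (use c QD \<delta> s0_pos in \<open>auto simp: split_beta\<close>)
    also have "cmod (integral {-pi..pi} (\<lambda>\<phi>. h (s0 + (L - s0)) (t0 + \<phi>) * kern (L - s0) \<phi>)) \<le>
        4 * pi * (C * exp (7 / 12 * L)) * exp (- (L - s0))"
      using s0_pos t0 h_le[of L]
      by (intro norm_kern_pairing_le) (auto intro!: continuous_on_slice)
    also have "\<dots> = 4 * pi * C * exp (7 / 12 * L + - (L - s0))"
      by (simp only: exp_add mult.assoc)
    finally show ?thesis by (simp add: algebra_simps)
  qed
  \<comment> \<open>Reflection in (s0, t0) changes the sign of both derivatives, so the modulus of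
    the d-bar derivative is preserved and the same kernel estimate applies.\<close>
  have left: "cmod (integral {-pi..pi} (\<lambda>\<phi>. h (s0 - \<delta>) (t0 - \<phi>) * kern \<delta> \<phi>)) \<le>
      4 * pi * C * exp (- s0) + 2 * pi\<^sup>2 * Q + 6 / 5 * D"
    if \<delta>: "0 < \<delta>" "\<delta> < ln 2" for \<delta>
  proof -
    have mem: "s0 - \<sigma> \<in> {0..L}" "t0 - \<phi> \<in> {-pi..3 * pi}"
      if "\<sigma> \<in> {0..s0}" "\<phi> \<in> {-pi..pi}" for \<sigma> \<phi>
      using that t0 s0_pos by auto
    have c: "continuous_on ({0..s0} \<times> {-pi..pi}) (\<lambda>x. h (s0 - fst x) (t0 - snd x))"
      "continuous_on ({0..s0} \<times> {-pi..pi}) (\<lambda>x. hs (s0 - fst x) (t0 - snd x))"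
      "continuous_on ({0..s0} \<times> {-pi..pi}) (\<lambda>x. ht (s0 - fst x) (t0 - snd x))"
      by (rule continuous_on_uncurry[OF cont(1)] continuous_on_uncurry[OF cont(2)]
          continuous_on_uncurry[OF cont(3)]; use mem in \<open>auto intro!: continuous_intros\<close>)+
    have "cmod (integral {-pi..pi} (\<lambda>\<phi>. h (s0 - \<delta>) (t0 - \<phi>) * kern \<delta> \<phi>)) \<le>
      cmod (integral {-pi..pi} (\<lambda>\<phi>. h (s0 - s0) (t0 - \<phi>) * kern s0 \<phi>)) + 2 * pi\<^sup>2 * Q + 6 / 5 * D"
    proof (rule kern_pairing_bound[where k = "\<lambda>\<sigma> \<phi>. h (s0 - \<sigma>) (t0 - \<phi>)"
        and ks = "\<lambda>\<sigma> \<phi>. - hs (s0 - \<sigma>) (t0 - \<phi>)" and kp = "\<lambda>\<sigma> \<phi>. - ht (s0 - \<sigma>) (t0 - \<phi>)"])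
      fix \<sigma> \<phi> assume sp: "\<sigma> \<in> {0..s0}" "\<phi> \<in> {-pi..pi}"
      show "((\<lambda>\<sigma>. h (s0 - \<sigma>) (t0 - \<phi>)) has_vector_derivative - hs (s0 - \<sigma>) (t0 - \<phi>)) (at \<sigma>)"
      proof -
        have "((\<lambda>\<sigma>. s0 - \<sigma>) has_vector_derivative - 1) (at \<sigma>)" by (auto intro!: derivative_eq_intros)
        from vector_diff_chain_at[OF this hs[OF mem[OF sp]]] show ?thesis by (simp add: o_def)
      qed
      show "((\<lambda>\<phi>. h (s0 - \<sigma>) (t0 - \<phi>)) has_vector_derivative - ht (s0 - \<sigma>) (t0 - \<phi>)) (at \<phi>)"
      proof -
        have "((\<lambda>\<phi>. t0 - \<phi>) has_vector_derivative - 1) (at \<phi>)" by (auto intro!: derivative_eq_intros)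
        from vector_diff_chain_at[OF this ht[OF mem[OF sp]]] show ?thesis by (simp add: o_def)
      qed
      have "- hs (s0 - \<sigma>) (t0 - \<phi>) + \<i> * - ht (s0 - \<sigma>) (t0 - \<phi>) =
          - (hs (s0 - \<sigma>) (t0 - \<phi>) + \<i> * ht (s0 - \<sigma>) (t0 - \<phi>))" by simp
      then have "cmod (- hs (s0 - \<sigma>) (t0 - \<phi>) + \<i> * - ht (s0 - \<sigma>) (t0 - \<phi>)) \<le> C * exp (- (s0 - \<sigma>) / 4)"
        using dbar_le[OF mem[OF sp]] by (simp only: norm_minus_cancel)
      also have "- (s0 - \<sigma>) / 4 = - s0 / 4 + \<sigma> / 4" by (simp add: field_simps)
      finally show "cmod (- hs (s0 - \<sigma>) (t0 - \<phi>) + \<i> * - ht (s0 - \<sigma>) (t0 - \<phi>)) \<le> Q * exp (\<sigma> / 4)"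
        by (simp only: Q_def exp_add mult.assoc)
    next
      fix \<sigma> assume sp: "\<sigma> \<in> {0..s0}"
      have "\<bar>s0 - \<sigma> - s1\<bar> \<le> (s0 - s1) + \<sigma>" using sp s0_pos unfolding atLeastAtMost_iff by linarith
      then have "\<bar>s0 - \<sigma> - s1\<bar> / 6 \<le> ((s0 - s1) + \<sigma>) / 6" by (rule divide_right_mono) simp
      then have e: "\<bar>s0 - \<sigma> - s1\<bar> / 6 \<le> (s0 - s1) / 6 + \<sigma> / 6" by (simp only: add_divide_distrib)
      have "cmod (h (s0 - \<sigma>) (t0 + pi) - h (s0 - \<sigma>) (t0 - pi)) \<le> N * exp (\<bar>s0 - \<sigma> - s1\<bar> / 6)"
        using sp s0_pos by (intro jump_le[OF t0]) auto
      also have "\<dots> \<le> N * exp ((s0 - s1) / 6 + \<sigma> / 6)"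
        using e N_nonneg by (intro mult_left_mono) auto
      finally show "cmod (h (s0 - \<sigma>) (t0 - pi) - h (s0 - \<sigma>) (t0 - - pi)) \<le> D * exp (\<sigma> / 6)"
        by (simp only: D_def exp_add mult.assoc diff_minus_eq_add norm_minus_commute)
    qed (use c QD \<delta> s0_pos in \<open>auto simp: split_beta intro!: continuous_on_minus\<close>)
    also have "cmod (integral {-pi..pi} (\<lambda>\<phi>. h (s0 - s0) (t0 - \<phi>) * kern s0 \<phi>)) \<le>
        4 * pi * C * exp (- s0)"
    proof (rule norm_kern_pairing_le)
      show "continuous_on {-pi..pi} (\<lambda>\<phi>. h (s0 - s0) (t0 - \<phi>))"
        by (rule continuous_on_uncurry[OF cont(1)];
          use mem[of s0] s0_pos in \<open>auto intro!: continuous_intros\<close>)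
      show "cmod (h (s0 - s0) (t0 - \<phi>)) \<le> C" if "\<phi> \<in> {-pi..pi}" for \<phi>
        using h_le[OF mem[of s0 \<phi>]] that s0_pos by simp
    qed (use s0_pos in auto)
    finally show ?thesis by simp
  qed
  \<comment> \<open>A compact neighbourhood provides a Lipschitz constant for \<open>h\<close>. It
    may depend on the function: only its finiteness matters for the passage to the limit at the
    pole.\<close>
  define K where "K = {s0 - ln 2..s0 + ln 2} \<times> {t0 - pi..t0 + pi}"
  have K: "K \<subseteq> {0..L} \<times> {-pi..3 * pi}" using s0_pos t0 by (auto simp: K_def)
  have compact_K: "compact K" by (simp add: K_def compact_Times)
  have "bounded ((\<lambda>(s, t). hs s t) ` K)" "bounded ((\<lambda>(s, t). ht s t) ` K)"
    by (auto intro!: compact_imp_bounded compact_continuous_image compact_K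
        continuous_on_subset[OF cont(2) K] continuous_on_subset[OF cont(3) K])
  then obtain M1 M2 where M: "\<And>s t. (s, t) \<in> K \<Longrightarrow> cmod (hs s t) \<le> M1"
    "\<And>s t. (s, t) \<in> K \<Longrightarrow> cmod (ht s t) \<le> M2"
    unfolding bounded_iff by fast
  have lip: "cmod (h s t - h s0 t0) \<le> max M1 M2 * (\<bar>s - s0\<bar> + \<bar>t - t0\<bar>)"
    if "s \<in> {s0 - ln 2..s0 + ln 2}" "t \<in> {t0 - pi..t0 + pi}" for s t
  proof -
    have mem: "x \<in> {0..L}" if "x \<in> {s0 - ln 2..s0 + ln 2}" for x using that s0_pos by auto
    have memt: "x \<in> {-pi..3 * pi}" if "x \<in> {t0 - pi..t0 + pi}" for x using that t0 by auto
    have "cmod (h s t - h s0 t) \<le> M1 * \<bar>s - s0\<bar>"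
    proof (rule vector_differentiable_bound[where S = "{s0 - ln 2..s0 + ln 2}" and f' = "\<lambda>s. hs s t"])
      fix x assume x: "x \<in> {s0 - ln 2..s0 + ln 2}"
      show "((\<lambda>s. h s t) has_vector_derivative hs x t) (at x within {s0 - ln 2..s0 + ln 2})"
        by (intro has_vector_derivative_at_within[OF hs] mem memt x that)
      show "cmod (hs x t) \<le> M1" using x that(2) by (intro M(1)) (simp add: K_def)
    qed (use that ln2 in auto)
    moreover have "cmod (h s0 t - h s0 t0) \<le> M2 * \<bar>t - t0\<bar>"
    proof (rule vector_differentiable_bound[where S = "{t0 - pi..t0 + pi}" and f' = "ht s0"])
      fix x assume x: "x \<in> {t0 - pi..t0 + pi}"
      show "(h s0 has_vector_derivative ht s0 x) (at x within {t0 - pi..t0 + pi})"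
        using s0_pos by (intro has_vector_derivative_at_within[OF ht] memt x) auto
      show "cmod (ht s0 x) \<le> M2" using x ln2 by (intro M(2)) (simp add: K_def)
    qed (use that in auto)
    moreover have "M1 * \<bar>s - s0\<bar> \<le> max M1 M2 * \<bar>s - s0\<bar>" "M2 * \<bar>t - t0\<bar> \<le> max M1 M2 * \<bar>t - t0\<bar>"
      by (auto intro!: mult_right_mono)
    ultimately show ?thesis
      using norm_triangle_ineq[of "h s t - h s0 t" "h s0 t - h s0 t0"] by (simp add: distrib_left)
  qed
  have jump: "cmod (2 * of_real pi * h s0 t0 - mean t0 s0) \<le>
      (4 * pi * C * exp (s0 - 5 / 12 * L) + 2 * pi\<^sup>2 * Q + 6 / 5 * D) +
      (4 * pi * C * exp (- s0) + 2 * pi\<^sup>2 * Q + 6 / 5 * D)"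
    unfolding mean_def
    using continuous_on_subset[OF cont(1) K[unfolded K_def]] lip left right
    by (intro kern_pairing_jump[OF ln2])
  have rad: "cmod (mean t0 s0 - mean t0 s1) \<le> 8 * pi * C * exp (- s1 / 4) + 6 * N * exp ((s0 - s1) / 6)"
    using mean_radial[OF t0, of s0] s0_pos by simp
  note ang = mean_angular[OF t0]
  have "2 * of_real pi * h s0 t0 - mean pi s1 = (2 * of_real pi * h s0 t0 - mean t0 s0) +
     ((mean t0 s0 - mean t0 s1) + (mean t0 s1 - mean pi s1))" by simp
  then have "cmod (2 * of_real pi * h s0 t0 - mean pi s1) \<le> cmod (2 * of_real pi * h s0 t0 - mean t0 s0) +
     (cmod (mean t0 s0 - mean t0 s1) + cmod (mean t0 s1 - mean pi s1))"
    by (simp only:) (intro order_trans[OF norm_triangle_ineq] add_mono norm_triangle_ineq order_refl)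
  then show ?thesis using jump rad ang unfolding Q_def D_def by (simp add: algebra_simps)
qed

end

subsection \<open>Partial derivatives on the cover\<close>

text \<open>Writing U(s, t) - U(s, y - e2) as the integral of \<open>Ut\<close> and differentiating
  under the integral in s expresses \<open>Us\<close> as the integral of \<open>Uts\<close> up to a
  constant. The fundamental theorem of calculus in t then identifies the other mixed derivative at
  the point.\<close>

lemma mixed_derivatives_eq:
  fixes U :: "real \<Rightarrow> real \<Rightarrow> real"
  assumes W: "open W" "(x, y) \<in> W"
    and Us: "\<And>s t. (s, t) \<in> W \<Longrightarrow> ((\<lambda>s. U s t) has_real_derivative Us s t) (at s)"
    and Ut: "\<And>s t. (s, t) \<in> W \<Longrightarrow> (U s has_real_derivative Ut s t) (at t)"
    and Uts: "\<And>s t. (s, t) \<in> W \<Longrightarrow> ((\<lambda>s. Ut s t) has_real_derivative Uts s t) (at s)"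
    and cont: "continuous_on W (\<lambda>(s, t). Uts s t)"
    and Ust: "(Us x has_real_derivative d) (at y)"
  shows "d = Uts x y"
proof -
  obtain A B where AB: "open A" "open B" "x \<in> A" "y \<in> B" "A \<times> B \<subseteq> W"
    using open_prod_elim[OF W] by (metis mem_Sigma_iff)
  obtain e1 e2 where e12: "0 < e1" "cball x e1 \<subseteq> A" "0 < e2" "cball y e2 \<subseteq> B"
    using AB by (meson open_contains_cball)
  define I J where "I = {x - e1..x + e1}" and "J = {y - e2..y + e2}"
  have IJ: "(s, t) \<in> W" if "s \<in> I" "t \<in> J" for s t
  proof -
    have "s \<in> A" "t \<in> B"
      using that e12 unfolding I_def J_def cball_eq_atLeastAtMost by blast+
    then show ?thesis using AB by blast
  qed
  have xy: "x \<in> I" "y \<in> J" using e12 by (auto simp: I_def J_def)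
  have contUts: "continuous_on (I \<times> J) (\<lambda>(s, t). Uts s t)"
    by (rule continuous_on_subset[OF cont]) (use IJ in auto)
  have Ut_integral: "(Ut s has_integral U s t - U s (y - e2)) {y - e2..t}" if "s \<in> I" "t \<in> J" for s t
  proof (rule fundamental_theorem_of_calculus)
    fix \<tau> assume "\<tau> \<in> {y - e2..t}"
    then show "(U s has_vector_derivative Ut s \<tau>) (at \<tau> within {y - e2..t})"
      using that IJ[of s \<tau>] unfolding has_real_derivative_iff_has_vector_derivative[symmetric]
      by (intro has_field_derivative_at_within[OF Ut]) (auto simp: J_def)
  qed (use that in \<open>auto simp: J_def\<close>)
  have "Us x t - Us x (y - e2) = integral {y - e2..t} (Uts x)" if t: "t \<in> J" for t
  proof -
    have "((\<lambda>s. integral (cbox (y - e2) t) (Ut s)) has_vector_derivative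
        integral (cbox (y - e2) t) (Uts x)) (at x within I)"
    proof (rule leibniz_rule_vector_derivative)
      fix s \<tau> assume "s \<in> I" "\<tau> \<in> cbox (y - e2) t"
      then show "((\<lambda>s. Ut s \<tau>) has_vector_derivative Uts s \<tau>) (at s within I)"
        using t IJ[of s \<tau>] unfolding has_real_derivative_iff_has_vector_derivative[symmetric]
        by (intro has_field_derivative_at_within[OF Uts]) (auto simp: J_def)
    next
      fix s assume "s \<in> I"
      then show "Ut s integrable_on cbox (y - e2) t"
        using Ut_integral[OF _ t] by (auto simp: has_integral_integrable)
    next
      show "continuous_on (I \<times> cbox (y - e2) t) (\<lambda>(s, t). Uts s t)"
        by (rule continuous_on_subset[OF contUts]) (use t in \<open>auto simp: J_def\<close>)
    qed (use xy in \<open>auto simp: I_def\<close>)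
    from has_vector_derivative_transform[OF xy(1) _ this, of "\<lambda>s. U s t - U s (y - e2)"]
    have 1: "((\<lambda>s. U s t - U s (y - e2)) has_vector_derivative integral {y - e2..t} (Uts x)) (at x within I)"
      using integral_unique[OF Ut_integral[OF _ t]] by simp
    have "(x, t) \<in> W" "(x, y - e2) \<in> W" using xy t e12 by (auto intro!: IJ simp: J_def)
    then have "((\<lambda>s. U s t - U s (y - e2)) has_real_derivative Us x t - Us x (y - e2)) (at x)"
      by (intro DERIV_diff Us)
    then have 2: "((\<lambda>s. U s t - U s (y - e2)) has_vector_derivative Us x t - Us x (y - e2)) (at x within I)"
      by (simp add: has_real_derivative_iff_has_vector_derivative has_vector_derivative_at_within)
    have "at x within I = at x" using e12 by (auto simp: I_def intro!: at_within_Icc_at)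
    then show ?thesis using 1 2 by (auto intro: vector_derivative_unique_at)
  qed
  note eq = this
  have "continuous_on J (Uts x)"
    by (rule continuous_on_uncurry[OF contUts]) (use xy in \<open>auto intro!: continuous_intros\<close>)
  then have "((\<lambda>t. integral {y - e2..t} (Uts x)) has_real_derivative Uts x y) (at y within J)"
    unfolding J_def by (intro integral_has_real_derivative) (use xy in \<open>auto simp: J_def\<close>)
  then have "((\<lambda>t. Us x t - Us x (y - e2)) has_real_derivative Uts x y) (at y within J)"
    unfolding has_real_derivative_iff_has_vector_derivative
    using eq by (rule_tac has_vector_derivative_transform[OF xy(2)])
  moreover have "at y within J = at y" using e12 by (auto simp: J_def intro!: at_within_Icc_at)
  moreover have "((\<lambda>t. Us x t - Us x (y - e2)) has_real_derivative d) (at y)"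
    using DERIV_diff[OF Ust DERIV_const[of "Us x (y - e2)"]] by simp
  ultimately show ?thesis by (auto intro: DERIV_unique)
qed

text \<open>After rotation by -\<theta> the base point is the positive real number \<rho>, where the
  principal logarithm is holomorphic. Its real and imaginary parts give the logarithm of the radius
  and the angle relative to \<theta>.\<close>

lemma local_lift_line_has_vector_derivative:
  assumes "\<rho> > 0" "cmod e = 1"
  shows "((\<lambda>t. local_lift \<theta> (cover_proj (\<rho>, \<theta>) + e * of_real t)) has_vector_derivative
    (Re (e * cis (- \<theta>)), Im (e * cis (- \<theta>)) / \<rho>)) (at 0)"
proof -
  define a where "a = e * cis (- \<theta>)"
  define w where "w = (\<lambda>t. of_real \<rho> + of_real t * a)"
  have a: "cmod a = 1" using assms by (simp add: a_def norm_mult)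
  have w0: "w t \<noteq> 0" if "\<bar>t\<bar> < \<rho>" for t
  proof
    assume "w t = 0"
    then have "of_real \<rho> = - (of_real t * a)" by (simp add: w_def eq_neg_iff_add_eq_0)
    from arg_cong[OF this, of cmod] show False using that assms a by (simp add: norm_mult)
  qed
  \<comment> \<open>For |t| < \<rho> the rotated line avoids the origin, so Arg agrees with the
    imaginary part of Ln.\<close>
  have lift: "local_lift \<theta> (cover_proj (\<rho>, \<theta>) + e * of_real t) = (exp (Re (Ln (w t))), \<theta> + Im (Ln (w t)))"
    if "\<bar>t\<bar> < \<rho>" for t
  proof -
    have *: "(cover_proj (\<rho>, \<theta>) + e * of_real t) * cis (- \<theta>) = w t"
      by (simp add: cover_proj_def w_def a_def rcis_def distrib_right mult.assoc cis_mult)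
    have "cmod (cover_proj (\<rho>, \<theta>) + e * of_real t) = cmod (w t)"
      unfolding *[symmetric] by (simp add: norm_mult)
    then show ?thesis using w0[OF that] by (simp add: local_lift_def * Arg_eq_Im_Ln)
  qed
  have "complex_of_real \<rho> \<notin> \<real>\<^sub>\<le>\<^sub>0" using assms by (simp add: complex_nonpos_Reals_iff)
  then have L: "((\<lambda>t. Ln (w t)) has_vector_derivative a / of_real \<rho>) (at 0)"
  proof -
    have "(w has_vector_derivative a) (at 0)"
      unfolding w_def by (auto intro!: derivative_eq_intros)
    moreover have "(Ln has_field_derivative inverse (of_real \<rho>)) (at (w 0))"
      using \<open>complex_of_real \<rho> \<notin> \<real>\<^sub>\<le>\<^sub>0\<close> by (simp add: w_def has_field_derivative_Ln)
    ultimately show ?thesis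
      using field_vector_diff_chain_at[of w a 0 Ln] by (simp add: o_def divide_inverse)
  qed
  have Re: "((\<lambda>t. Re (Ln (w t))) has_real_derivative Re (a / of_real \<rho>)) (at 0)"
    and Im: "((\<lambda>t. Im (Ln (w t))) has_real_derivative Im (a / of_real \<rho>)) (at 0)"
    using bounded_linear.has_vector_derivative[OF bounded_linear_Re L]
      bounded_linear.has_vector_derivative[OF bounded_linear_Im L]
    by (simp_all add: has_real_derivative_iff_has_vector_derivative)
  have "exp (Re (Ln (w 0))) = \<rho>" using assms by (simp add: w_def)
  then have "((\<lambda>t. exp (Re (Ln (w t)))) has_real_derivative Re a) (at 0)"
    using DERIV_fun_exp[OF Re] assms by simp
  moreover have "((\<lambda>t. \<theta> + Im (Ln (w t))) has_real_derivative Im a / \<rho>) (at 0)"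
    using DERIV_add[OF DERIV_const Im] by simp
  ultimately have "((\<lambda>t. (exp (Re (Ln (w t))), \<theta> + Im (Ln (w t)))) has_vector_derivative (Re a, Im a / \<rho>)) (at 0)"
    unfolding has_real_derivative_iff_has_vector_derivative by (intro has_vector_derivative_Pair)
  then show ?thesis
    unfolding a_def[symmetric]
    by (rule has_vector_derivative_transform_within_open[of _ _ _ "{- \<rho><..<\<rho>}"])
      (use assms lift in \<open>auto simp: abs_less_iff\<close>)
qed

text \<open>Chain rule along the lifted lines in the directions 1 and i. As \<open>deriv\<close> is
  a total operator, differentiability is what gives the partials their meaning.\<close>

lemma has_derivative_imp_partials:
  assumes v: "(v has_derivative D) (at (\<rho>, \<theta>))" and \<rho>: "\<rho> > 0"
  shows "partial_x v (\<rho>, \<theta>) = D (cos \<theta>, - sin \<theta> / \<rho>)"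
    and "partial_y v (\<rho>, \<theta>) = D (sin \<theta>, cos \<theta> / \<rho>)"
proof -
  have *: "deriv (\<lambda>t. v (local_lift \<theta> (cover_proj (\<rho>, \<theta>) + e * of_real t))) 0 =
      D (Re (e * cis (- \<theta>)), Im (e * cis (- \<theta>)) / \<rho>)" if e: "cmod e = 1" for e
  proof -
    have "local_lift \<theta> (cover_proj (\<rho>, \<theta>) + e * of_real 0) = (\<rho>, \<theta>)"
      using local_lift_cover_proj[of "(\<rho>, \<theta>)"] \<rho> by (simp add: univ_cover_def)
    then have "((\<lambda>t. v (local_lift \<theta> (cover_proj (\<rho>, \<theta>) + e * of_real t))) has_derivative
        (\<lambda>h. D (h *\<^sub>R (Re (e * cis (- \<theta>)), Im (e * cis (- \<theta>)) / \<rho>)))) (at 0)"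
      using has_derivative_compose[OF local_lift_line_has_vector_derivative[OF \<rho> e, of \<theta>,
          unfolded has_vector_derivative_def], of v D] v
      by simp
    then have "((\<lambda>t. v (local_lift \<theta> (cover_proj (\<rho>, \<theta>) + e * of_real t))) has_real_derivative
        D (Re (e * cis (- \<theta>)), Im (e * cis (- \<theta>)) / \<rho>)) (at 0)"
      unfolding has_real_derivative_iff_has_vector_derivative has_vector_derivative_def
      by (simp only: linear_scale[OF has_derivative_linear[OF v]])
    then show ?thesis by (rule DERIV_imp_deriv)
  qed
  show "partial_x v (\<rho>, \<theta>) = D (cos \<theta>, - sin \<theta> / \<rho>)"
    using *[of 1] by (simp add: partial_x_def)
  show "partial_y v (\<rho>, \<theta>) = D (sin \<theta>, cos \<theta> / \<rho>)"
    using *[of \<i>] by (simp add: partial_y_def)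
qed

text \<open>The radial and angular unit vectors arise from the x and y directions by rotation
  through \<theta>, so inverting the previous formulas only needs cos^2 + sin^2 = 1.\<close>

lemma has_derivative_from_partials:
  assumes v: "(v has_derivative D) (at (\<rho>, \<theta>))" and \<rho>: "\<rho> > 0"
  shows "D (1, 0) = cos \<theta> * partial_x v (\<rho>, \<theta>) + sin \<theta> * partial_y v (\<rho>, \<theta>)"
    and "D (0, 1) = \<rho> * (- sin \<theta> * partial_x v (\<rho>, \<theta>) + cos \<theta> * partial_y v (\<rho>, \<theta>))"
proof -
  note lin = has_derivative_linear[OF v]
  have D: "D (x, y) = x * D (1, 0) + y * D (0, 1)" for x y
    using linear_add[OF lin, of "(x, 0)" "(0, y)"] linear_scale[OF lin, of x "(1, 0)"]
      linear_scale[OF lin, of y "(0, 1)"] by simp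
  define c s where "c = cos \<theta>" and "s = sin \<theta>"
  have cs: "c * c + s * s = 1" unfolding c_def s_def by (metis sin_cos_squared_add3)
  note p = has_derivative_imp_partials[OF assms, unfolded D[of "cos \<theta>"] D[of "sin \<theta>"], folded c_def s_def]
  have "c * partial_x v (\<rho>, \<theta>) + s * partial_y v (\<rho>, \<theta>) = (c * c + s * s) * D (1, 0)"
    unfolding p by (simp add: algebra_simps)
  then show "D (1, 0) = cos \<theta> * partial_x v (\<rho>, \<theta>) + sin \<theta> * partial_y v (\<rho>, \<theta>)"
    unfolding cs by (simp add: c_def s_def)
  have "\<rho> * (- s * partial_x v (\<rho>, \<theta>) + c * partial_y v (\<rho>, \<theta>)) = (c * c + s * s) * D (0, 1)"
    unfolding p using \<rho> by (simp add: algebra_simps)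
  then show "D (0, 1) = \<rho> * (- sin \<theta> * partial_x v (\<rho>, \<theta>) + cos \<theta> * partial_y v (\<rho>, \<theta>))"
    unfolding cs by (simp add: c_def s_def)
qed

text \<open>Both derivatives carry the same factor exp s: logarithmic coordinates are
  conformal.\<close>

lemma log_coordinate_derivatives:
  assumes "v differentiable (at (exp s, \<theta>))"
  shows "((\<lambda>s. v (exp s, \<theta>)) has_real_derivative
      exp s * (cos \<theta> * partial_x v (exp s, \<theta>) + sin \<theta> * partial_y v (exp s, \<theta>))) (at s)"
    and "((\<lambda>\<theta>. v (exp s, \<theta>)) has_real_derivative
      exp s * (- sin \<theta> * partial_x v (exp s, \<theta>) + cos \<theta> * partial_y v (exp s, \<theta>))) (at \<theta>)"
proof -
  obtain D where D: "(v has_derivative D) (at (exp s, \<theta>))"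
    using assms by (auto simp: differentiable_def)
  note lin = has_derivative_linear[OF D]
  note d = has_derivative_from_partials[OF D exp_gt_zero]
  have "((\<lambda>s. (exp s, \<theta>)) has_derivative (\<lambda>h. h *\<^sub>R (exp s, 0))) (at s)"
    by (auto intro!: derivative_eq_intros)
  from has_derivative_compose[OF this D]
  have "((\<lambda>s. v (exp s, \<theta>)) has_real_derivative D (exp s, 0)) (at s)"
    unfolding has_real_derivative_iff_has_vector_derivative has_vector_derivative_def
    by (simp only: linear_scale[OF lin])
  moreover have "D (exp s, 0) = exp s * D (1, 0)"
    using linear_scale[OF lin, of "exp s" "(1, 0)"] by simp
  ultimately show "((\<lambda>s. v (exp s, \<theta>)) has_real_derivative
      exp s * (cos \<theta> * partial_x v (exp s, \<theta>) + sin \<theta> * partial_y v (exp s, \<theta>))) (at s)"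
    by (simp only: d)
  have "((\<lambda>\<theta>. (exp s, \<theta>)) has_derivative (\<lambda>h. h *\<^sub>R (0, 1))) (at \<theta>)"
    by (auto intro!: derivative_eq_intros)
  from has_derivative_compose[OF this D]
  have "((\<lambda>\<theta>. v (exp s, \<theta>)) has_real_derivative D (0, 1)) (at \<theta>)"
    unfolding has_real_derivative_iff_has_vector_derivative has_vector_derivative_def
    by (simp only: linear_scale[OF lin])
  then show "((\<lambda>\<theta>. v (exp s, \<theta>)) has_real_derivative
      exp s * (- sin \<theta> * partial_x v (exp s, \<theta>) + cos \<theta> * partial_y v (exp s, \<theta>))) (at \<theta>)"
    by (simp only: d)
qed

text \<open>The deck translation \<theta> \<mapsto> \<theta> + 2 \<pi> preserves the x and y
  directions, so it commutes with the gradient. Consequently the jump of \<zeta> f across a slit is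
  \<zeta> times the complex gradient of w.\<close>

lemma complex_gradient_separation:
  assumes "u differentiable (at (\<rho>, \<theta>))" "u differentiable (at (\<rho>, \<theta> + 2 * pi))" "\<rho> > 0"
  shows "complex_gradient (separation u) (\<rho>, \<theta>) =
    complex_gradient u (\<rho>, \<theta> + 2 * pi) - complex_gradient u (\<rho>, \<theta>)"
    and "separation u differentiable (at (\<rho>, \<theta>))"
proof -
  obtain D1 D2 where D: "(u has_derivative D1) (at (\<rho>, \<theta>))" "(u has_derivative D2) (at (\<rho>, \<theta> + 2 * pi))"
    using assms by (auto simp: differentiable_def)
  have "((\<lambda>z. (fst z, snd z + 2 * pi)) has_derivative (\<lambda>h. h)) (at (\<rho>, \<theta>))"
    by (auto intro!: derivative_eq_intros)
  from has_derivative_compose[OF this, of u D2] D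
  have w: "(separation u has_derivative (\<lambda>h. D2 h - D1 h)) (at (\<rho>, \<theta>))"
    unfolding separation_def[abs_def] by (intro has_derivative_diff) auto
  then show "separation u differentiable (at (\<rho>, \<theta>))" by (auto simp: differentiable_def)
  show "complex_gradient (separation u) (\<rho>, \<theta>) =
    complex_gradient u (\<rho>, \<theta> + 2 * pi) - complex_gradient u (\<rho>, \<theta>)"
    unfolding complex_gradient_def has_derivative_imp_partials[OF w assms(3)]
      has_derivative_imp_partials[OF D(1) assms(3)] has_derivative_imp_partials[OF D(2) assms(3)]
    by simp (simp add: algebra_simps)
qed

lemma norm_gradient: "norm (gradient u \<zeta>) = cmod (complex_gradient u \<zeta>)"
  by (simp add: gradient_def complex_gradient_def norm_Pair cmod_def)

subsection \<open>The gradient in logarithmic coordinates\<close>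

definition log_gradient :: "(real \<times> real \<Rightarrow> real) \<Rightarrow> real \<Rightarrow> real \<Rightarrow> complex" where
  "log_gradient u s t = exp (Complex s t) * complex_gradient u (exp s, t)"

text \<open>This formula and the next are what the product rule and
  \<open>log_coordinate_derivatives\<close> give for the s- and t-derivatives of
  \<open>log_gradient\<close>. Spelled out in the partials of u, they make continuity and the d-bar
  identity directly accessible.\<close>

definition log_gradient_s :: "(real \<times> real \<Rightarrow> real) \<Rightarrow> real \<Rightarrow> real \<Rightarrow> complex" where
  "log_gradient_s u s t = exp (Complex s t) * (complex_gradient u (exp s, t) + of_real (exp s) *
     (of_real (cos t * partial_x (partial_x u) (exp s, t) + sin t * partial_y (partial_x u) (exp s, t)) -
      \<i> * of_real (cos t * partial_x (partial_y u) (exp s, t) + sin t * partial_y (partial_y u) (exp s, t))))"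

definition log_gradient_t :: "(real \<times> real \<Rightarrow> real) \<Rightarrow> real \<Rightarrow> real \<Rightarrow> complex" where
  "log_gradient_t u s t = exp (Complex s t) * (\<i> * complex_gradient u (exp s, t) + of_real (exp s) *
     (of_real (- sin t * partial_x (partial_x u) (exp s, t) + cos t * partial_y (partial_x u) (exp s, t)) -
      \<i> * of_real (- sin t * partial_x (partial_y u) (exp s, t) + cos t * partial_y (partial_y u) (exp s, t))))"

context
  fixes u :: "real \<times> real \<Rightarrow> real" and U :: "(real \<times> real) set"
  assumes U: "open U" and u: "C2_open U u"
begin

lemma C2_open_differentiable:
  assumes "\<zeta> \<in> U"
  shows "u differentiable (at \<zeta>)" "partial_x u differentiable (at \<zeta>)" "partial_y u differentiable (at \<zeta>)"
  using u assms U unfolding C2_open_def C1_open_def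
  by (auto simp: differentiable_on_eq_differentiable_at)

lemma C2_open_continuous:
  "continuous_on U (partial_x u)" "continuous_on U (partial_y u)"
  "continuous_on U (partial_x (partial_x u))" "continuous_on U (partial_y (partial_x u))"
  "continuous_on U (partial_x (partial_y u))" "continuous_on U (partial_y (partial_y u))"
  using u unfolding C2_open_def C1_open_def by auto

lemma log_gradient_has_vector_derivative:
  assumes "(exp s, t) \<in> U"
  shows "((\<lambda>s. log_gradient u s t) has_vector_derivative log_gradient_s u s t) (at s)"
    and "(log_gradient u s has_vector_derivative log_gradient_t u s t) (at t)"
proof -
  note P = log_coordinate_derivatives[OF C2_open_differentiable(2)[OF assms]]
  note R = log_coordinate_derivatives[OF C2_open_differentiable(3)[OF assms]]
  have e: "((\<lambda>s. exp (Complex s t)) has_vector_derivative exp (Complex s t)) (at s)"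
    "((\<lambda>t. exp (Complex s t)) has_vector_derivative \<i> * exp (Complex s t)) (at t)"
    using field_vector_diff_chain_at[OF Complex_has_vector_derivative_Re DERIV_exp]
      field_vector_diff_chain_at[OF Complex_has_vector_derivative_Im DERIV_exp]
    by (simp_all add: o_def)
  note d = has_vector_derivative_mult[OF _ has_vector_derivative_diff[OF has_vector_derivative_of_real
    has_vector_derivative_mult_right[where a = \<i>, OF has_vector_derivative_of_real]]]
  show "((\<lambda>s. log_gradient u s t) has_vector_derivative log_gradient_s u s t) (at s)"
    using d[OF e(1) P(1) R(1)]
    by (simp add: log_gradient_def[abs_def] complex_gradient_def log_gradient_s_def algebra_simps)
  show "(log_gradient u s has_vector_derivative log_gradient_t u s t) (at t)"
    using d[OF e(2) P(2) R(2)]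
    by (simp add: log_gradient_def[abs_def] complex_gradient_def log_gradient_t_def algebra_simps)
qed

lemma continuous_on_log_gradient:
  assumes K: "\<And>s t. (s, t) \<in> K \<Longrightarrow> (exp s, t) \<in> U"
  shows "continuous_on K (\<lambda>(s, t). log_gradient u s t)"
    "continuous_on K (\<lambda>(s, t). log_gradient_s u s t)"
    "continuous_on K (\<lambda>(s, t). log_gradient_t u s t)"
proof -
  have *: "continuous_on K (\<lambda>x. v (exp (fst x), snd x))" if "continuous_on U v" for v :: "real \<times> real \<Rightarrow> real"
    by (rule continuous_on_compose2[OF that]) (use K in \<open>auto intro!: continuous_intros\<close>)
  note c = C2_open_continuous[THEN *]
  show "continuous_on K (\<lambda>(s, t). log_gradient u s t)"
    "continuous_on K (\<lambda>(s, t). log_gradient_s u s t)"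
    "continuous_on K (\<lambda>(s, t). log_gradient_t u s t)"
    unfolding split_beta log_gradient_def log_gradient_s_def log_gradient_t_def complex_gradient_def Complex_eq
    by (intro continuous_intros c)+
qed

text \<open>Symmetry is proved in the (s, t) coordinates, where u has ordinary mixed derivatives.
  Translating back, the first-order terms cancel and a factor cos^2 + sin^2 remains.\<close>

lemma partials_commute:
  assumes "(\<rho>, \<theta>) \<in> U" "\<rho> > 0"
  shows "partial_y (partial_x u) (\<rho>, \<theta>) = partial_x (partial_y u) (\<rho>, \<theta>)"
proof -
  define x where "x = ln \<rho>"
  have x: "exp x = \<rho>" using assms by (simp add: x_def)
  define W where "W = (\<lambda>(s, t). (exp s, t)) -` U"
  have W: "open W" unfolding W_def split_beta
    by (rule open_vimage[OF U]) (intro continuous_intros)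
  have xW: "(x, \<theta>) \<in> W" using assms x by (simp add: W_def)
  define P R where "P = (\<lambda>s t. partial_x u (exp s, t))" and "R = (\<lambda>s t. partial_y u (exp s, t))"
  define Ps Pt Rs Rt where
    "Ps = (\<lambda>s t. exp s * (cos t * partial_x (partial_x u) (exp s, t) + sin t * partial_y (partial_x u) (exp s, t)))"
    and "Pt = (\<lambda>s t. exp s * (- sin t * partial_x (partial_x u) (exp s, t) + cos t * partial_y (partial_x u) (exp s, t)))"
    and "Rs = (\<lambda>s t. exp s * (cos t * partial_x (partial_y u) (exp s, t) + sin t * partial_y (partial_y u) (exp s, t)))"
    and "Rt = (\<lambda>s t. exp s * (- sin t * partial_x (partial_y u) (exp s, t) + cos t * partial_y (partial_y u) (exp s, t)))"
  have PR: "((\<lambda>s. P s t) has_real_derivative Ps s t) (at s)" "(P s has_real_derivative Pt s t) (at t)"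
    "((\<lambda>s. R s t) has_real_derivative Rs s t) (at s)" "(R s has_real_derivative Rt s t) (at t)"
    if "(s, t) \<in> W" for s t
    using log_coordinate_derivatives[OF C2_open_differentiable(2), of s t]
      log_coordinate_derivatives[OF C2_open_differentiable(3), of s t] that
    by (simp_all add: W_def P_def R_def Ps_def Pt_def Rs_def Rt_def)
  \<comment> \<open>The left side is the t-derivative of u_s, the right side the s-derivative of
    u_t.\<close>
  have "exp x * (- sin \<theta> * P x \<theta> + cos \<theta> * Pt x \<theta> + (cos \<theta> * R x \<theta> + sin \<theta> * Rt x \<theta>)) =
      exp x * (- sin \<theta> * P x \<theta> + cos \<theta> * R x \<theta>) + exp x * (- sin \<theta> * Ps x \<theta> + cos \<theta> * Rs x \<theta>)"
  proof (rule mixed_derivatives_eq[OF W xW, where U = "\<lambda>s t. u (exp s, t)"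
        and Us = "\<lambda>s t. exp s * (cos t * P s t + sin t * R s t)"
        and Ut = "\<lambda>s t. exp s * (- sin t * P s t + cos t * R s t)"
        and Uts = "\<lambda>s t. exp s * (- sin t * P s t + cos t * R s t) + exp s * (- sin t * Ps s t + cos t * Rs s t)"])
    fix s t assume st: "(s, t) \<in> W"
    then have "(exp s, t) \<in> U" by (simp add: W_def)
    note d = log_coordinate_derivatives[OF C2_open_differentiable(1)[OF this]]
    show "((\<lambda>s. u (exp s, t)) has_real_derivative exp s * (cos t * P s t + sin t * R s t)) (at s)"
      using d(1) by (simp add: P_def R_def)
    show "((\<lambda>t. u (exp s, t)) has_real_derivative exp s * (- sin t * P s t + cos t * R s t)) (at t)"
      using d(2) by (simp add: P_def R_def)
    show "((\<lambda>s. exp s * (- sin t * P s t + cos t * R s t)) has_real_derivative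
        exp s * (- sin t * P s t + cos t * R s t) + exp s * (- sin t * Ps s t + cos t * Rs s t)) (at s)"
      by (rule derivative_eq_intros PR[OF st] refl)+ (simp add: algebra_simps)
  next
    have *: "continuous_on W (\<lambda>x. v (exp (fst x), snd x))" if "continuous_on U v" for v :: "real \<times> real \<Rightarrow> real"
      by (rule continuous_on_compose2[OF that]) (auto simp: W_def intro!: continuous_intros)
    note c = C2_open_continuous[THEN *]
    show "continuous_on W (\<lambda>(s, t). exp s * (- sin t * P s t + cos t * R s t) + exp s * (- sin t * Ps s t + cos t * Rs s t))"
      unfolding split_beta P_def R_def Ps_def Rs_def by (intro continuous_intros c)
  next
    show "((\<lambda>t. exp x * (cos t * P x t + sin t * R x t)) has_real_derivative
        exp x * (- sin \<theta> * P x \<theta> + cos \<theta> * Pt x \<theta> + (cos \<theta> * R x \<theta> + sin \<theta> * Rt x \<theta>))) (at \<theta>)"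
      by (rule derivative_eq_intros PR[OF xW] refl)+ (simp add: algebra_simps)
  qed
  then have "exp x * (cos \<theta> * Pt x \<theta> + sin \<theta> * Rt x \<theta>) = exp x * (- sin \<theta> * Ps x \<theta> + cos \<theta> * Rs x \<theta>)"
    by (simp add: algebra_simps)
  then have eq: "cos \<theta> * Pt x \<theta> + sin \<theta> * Rt x \<theta> = - sin \<theta> * Ps x \<theta> + cos \<theta> * Rs x \<theta>"
    by simp
  define c s where "c = cos \<theta>" and "s = sin \<theta>"
  have cs: "c * c + s * s = 1" unfolding c_def s_def by (metis sin_cos_squared_add3)
  have "exp x * ((c * c + s * s) * partial_y (partial_x u) (\<rho>, \<theta>)) =
      exp x * ((c * c + s * s) * partial_x (partial_y u) (\<rho>, \<theta>))"
    using eq unfolding Ps_def Pt_def Rs_def Rt_def x c_def[symmetric] s_def[symmetric]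
    by (simp add: algebra_simps)
  then show ?thesis unfolding cs by simp
qed

text \<open>In these coordinates \<partial>_s + i \<partial>_t is conj(\<zeta>) (\<partial>_x + i
  \<partial>_y), which annihilates the holomorphic factor \<zeta>. Applied to u_x - i u_y it leaves
  conj(\<zeta>) \<Delta>u, because the mixed partials cancel.\<close>

lemma log_gradient_dbar:
  assumes "(exp s, t) \<in> U"
  shows "log_gradient_s u s t + \<i> * log_gradient_t u s t = of_real (exp (2 * s) * laplacian u (exp s, t))"
proof -
  \<comment> \<open>A single variable q stands for both mixed partials, identified by
    \<open>partials_commute\<close>; p and r are the pure second derivatives.\<close>
  have alg: "E * (f + e * ((c * p + d * q) - \<i> * (c * q + d * r))) +
      \<i> * (E * (\<i> * f + e * ((- d * p + c * q) - \<i> * (- d * q + c * r)))) = E * e * (c - \<i> * d) * (p + r)"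
    for E f e c d p q r :: complex
    by (simp add: algebra_simps)
  have "of_real (cos t) - \<i> * of_real (sin t) = cis (- t)"
    by (simp add: complex_eq_iff)
  moreover have "exp (Complex s t) = of_real (exp s) * cis t" by (simp add: exp_eq_polar)
  ultimately have "exp (Complex s t) * of_real (exp s) * (of_real (cos t) - \<i> * of_real (sin t)) =
      of_real (exp s) * of_real (exp s) * (cis t * cis (- t))"
    by (simp only: mult_ac)
  also have "\<dots> = of_real (exp (2 * s))"
    by (simp add: cis_mult exp_double power2_eq_square)
  finally show ?thesis
    unfolding log_gradient_s_def log_gradient_t_def partials_commute[OF assms exp_gt_zero]
      of_real_add of_real_mult of_real_minus alg laplacian_def
    by (simp only:)
qed

end

section \<open>Growth of the separation\<close>

text \<open>The function \<phi>^2 exp (- 2 k x) is nonincreasing. Squaring avoids both division by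
  \<phi> and differentiation of its absolute value, and reflection covers the case b < a.\<close>

lemma log_growth:
  fixes \<phi> :: "real \<Rightarrow> real"
  assumes d: "\<And>x. x \<in> closed_segment a b \<Longrightarrow> (\<phi> has_real_derivative \<phi>' x) (at x)"
    and b: "\<And>x. x \<in> closed_segment a b \<Longrightarrow> \<bar>\<phi>' x\<bar> \<le> k * \<bar>\<phi> x\<bar>"
  shows "\<bar>\<phi> b\<bar> \<le> exp (k * \<bar>b - a\<bar>) * \<bar>\<phi> a\<bar>"
proof -
  have main: "\<bar>f q\<bar> \<le> exp (k * (q - p)) * \<bar>f p\<bar>"
    if pq: "p \<le> q" and d: "\<And>x. x \<in> {p..q} \<Longrightarrow> (f has_real_derivative f' x) (at x)"
      and b: "\<And>x. x \<in> {p..q} \<Longrightarrow> \<bar>f' x\<bar> \<le> k * \<bar>f x\<bar>" for f f' :: "real \<Rightarrow> real" and p q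
  proof -
    define g where "g = (\<lambda>x. (f x)\<^sup>2 * exp (- 2 * k * x))"
    have "g q \<le> g p"
    proof (rule DERIV_nonpos_imp_nonincreasing[OF pq])
      fix x assume x: "p \<le> x" "x \<le> q"
      have "(g has_real_derivative (2 * (f x * f' x) - 2 * (k * (f x)\<^sup>2)) * exp (- 2 * k * x)) (at x)"
        unfolding g_def using d[of x] x
        by (auto intro!: derivative_eq_intros simp: power2_eq_square algebra_simps)
      moreover have "f x * f' x \<le> k * (f x)\<^sup>2"
      proof -
        have "f x * f' x \<le> \<bar>f x\<bar> * \<bar>f' x\<bar>" by (simp flip: abs_mult)
        also have "\<dots> \<le> \<bar>f x\<bar> * (k * \<bar>f x\<bar>)" using b[of x] x by (intro mult_left_mono) auto
        also have "\<dots> = k * (f x)\<^sup>2" by (simp add: power2_eq_square)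
        finally show ?thesis .
      qed
      ultimately show "\<exists>y. (g has_real_derivative y) (at x) \<and> y \<le> 0"
        by (intro exI[of _ "(2 * (f x * f' x) - 2 * (k * (f x)\<^sup>2)) * exp (- 2 * k * x)"])
          (auto simp: mult_le_0_iff)
    qed
    then have "(f q)\<^sup>2 * exp (- 2 * k * q) * exp (2 * k * q) \<le> (f p)\<^sup>2 * exp (- 2 * k * p) * exp (2 * k * q)"
      unfolding g_def by (intro mult_right_mono) auto
    then have "(f q)\<^sup>2 \<le> (f p)\<^sup>2 * exp (2 * (k * (q - p)))"
      by (simp add: mult.assoc algebra_simps flip: exp_add)
    also have "\<dots> = (exp (k * (q - p)) * \<bar>f p\<bar>)\<^sup>2"
      unfolding exp_double by (simp add: power_mult_distrib)
    finally have "\<bar>f q\<bar>\<^sup>2 \<le> (exp (k * (q - p)) * \<bar>f p\<bar>)\<^sup>2" by simp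
    then show ?thesis by (rule power2_le_imp_le) simp
  qed
  show ?thesis
  proof (cases "a \<le> b")
    case True
    then show ?thesis using main[OF True, of \<phi> \<phi>'] d b by (simp add: closed_segment_eq_real_ivl)
  next
    case False
    have "\<bar>\<phi> (- (- b))\<bar> \<le> exp (k * (- b - - a)) * \<bar>\<phi> (- (- a))\<bar>"
    proof (rule main[where f = "\<lambda>x. \<phi> (- x)" and f' = "\<lambda>x. - \<phi>' (- x)"])
      fix x assume x: "x \<in> {- a..- b}"
      then have mem: "- x \<in> closed_segment a b" using False by (auto simp: closed_segment_eq_real_ivl)
      show "((\<lambda>x. \<phi> (- x)) has_real_derivative - \<phi>' (- x)) (at x)"
        using d[OF mem] by (simp add: DERIV_mirror)
      show "\<bar>- \<phi>' (- x)\<bar> \<le> k * \<bar>\<phi> (- x)\<bar>" using b[OF mem] by simp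
    qed (use False in simp)
    then show ?thesis using False by simp
  qed
qed

text \<open>The points are joined by an arc at radius exp s0 followed by a radial segment at angle
  t; both stay in the sector because it is a product in polar coordinates. Along each leg
  Cauchy--Schwarz bounds the logarithmic derivative of w by k.\<close>

lemma separation_growth:
  assumes diff: "\<And>\<zeta>. \<zeta> \<in> polar_sector r R a b \<Longrightarrow> separation u differentiable (at \<zeta>)"
    and grad: "\<And>\<zeta>. \<zeta> \<in> polar_sector r R a b \<Longrightarrow>
      fst \<zeta> * norm (gradient (separation u) \<zeta>) \<le> k * \<bar>separation u \<zeta>\<bar>"
    and mem: "(exp s0, t0) \<in> polar_sector r R a b" "(exp s, t) \<in> polar_sector r R a b"
  shows "\<bar>separation u (exp s, t)\<bar> \<le> exp (k * (\<bar>s - s0\<bar> + \<bar>t - t0\<bar>)) * \<bar>separation u (exp s0, t0)\<bar>"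
proof -
  let ?w = "separation u"
  have dir: "\<bar>x * partial_x ?w \<zeta> + y * partial_y ?w \<zeta>\<bar> \<le> norm (gradient ?w \<zeta>)" if "x\<^sup>2 + y\<^sup>2 = 1" for x y \<zeta>
    using Cauchy_Schwarz_ineq2[of "(x, y)" "gradient ?w \<zeta>"] that
    by (simp add: gradient_def norm_Pair)
  have bound: "\<bar>exp x * (c * partial_x ?w (exp x, y) + d * partial_y ?w (exp x, y))\<bar> \<le> k * \<bar>?w (exp x, y)\<bar>"
    if "(exp x, y) \<in> polar_sector r R a b" "c\<^sup>2 + d\<^sup>2 = 1" for x y c d
  proof -
    have "\<bar>exp x * (c * partial_x ?w (exp x, y) + d * partial_y ?w (exp x, y))\<bar> \<le>
        exp x * norm (gradient ?w (exp x, y))"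
      unfolding abs_mult using dir[OF that(2)] by (simp add: mult_left_mono)
    then show ?thesis using grad[OF that(1)] by simp
  qed
  have "\<bar>?w (exp s0, t)\<bar> \<le> exp (k * \<bar>t - t0\<bar>) * \<bar>?w (exp s0, t0)\<bar>"
  proof (rule log_growth)
    fix x assume "x \<in> closed_segment t0 t"
    then have m: "(exp s0, x) \<in> polar_sector r R a b"
      using mem by (auto simp: polar_sector_def univ_cover_def closed_segment_eq_real_ivl split: if_splits)
    show "((\<lambda>t. ?w (exp s0, t)) has_real_derivative
        exp s0 * (- sin x * partial_x ?w (exp s0, x) + cos x * partial_y ?w (exp s0, x))) (at x)"
      by (rule log_coordinate_derivatives(2)[OF diff[OF m]])
    show "\<bar>exp s0 * (- sin x * partial_x ?w (exp s0, x) + cos x * partial_y ?w (exp s0, x))\<bar> \<le> k * \<bar>?w (exp s0, x)\<bar>"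
      by (rule bound[OF m]) simp
  qed
  then have "exp (k * \<bar>s - s0\<bar>) * \<bar>?w (exp s0, t)\<bar> \<le> exp (k * \<bar>s - s0\<bar>) * (exp (k * \<bar>t - t0\<bar>) * \<bar>?w (exp s0, t0)\<bar>)"
    by (intro mult_left_mono) auto
  moreover have "\<bar>?w (exp s, t)\<bar> \<le> exp (k * \<bar>s - s0\<bar>) * \<bar>?w (exp s0, t)\<bar>"
  proof (rule log_growth)
    fix x assume "x \<in> closed_segment s0 s"
    then have "exp x \<in> {exp s0..exp s} \<or> exp x \<in> {exp s..exp s0}"
      by (auto simp: closed_segment_eq_real_ivl split: if_splits)
    then have m: "(exp x, t) \<in> polar_sector r R a b"
      using mem unfolding polar_sector_def univ_cover_def atLeastAtMost_iff mem_Collect_eq fst_conv snd_conv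
      by linarith
    show "((\<lambda>s. ?w (exp s, t)) has_real_derivative
        exp x * (cos t * partial_x ?w (exp x, t) + sin t * partial_y ?w (exp x, t))) (at x)"
      by (rule log_coordinate_derivatives(1)[OF diff[OF m]])
    show "\<bar>exp x * (cos t * partial_x ?w (exp x, t) + sin t * partial_y ?w (exp x, t))\<bar> \<le> k * \<bar>?w (exp x, t)\<bar>"
      by (rule bound[OF m]) simp
  qed
  ultimately have "\<bar>?w (exp s, t)\<bar> \<le> exp (k * \<bar>s - s0\<bar>) * (exp (k * \<bar>t - t0\<bar>) * \<bar>?w (exp s0, t0)\<bar>)"
    by (rule order_trans[rotated])
  then show ?thesis by (simp add: distrib_left exp_add mult.assoc)
qed

section \<open>Collecting the errors and the proof of the estimate\<close>

lemma cover_proj_exp: "cover_proj (exp s, t) = exp (Complex s t)"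
  by (simp add: cover_proj_def rcis_def exp_eq_polar)

text \<open>Passing from 2 \<pi> \<zeta> g to g divides the strip estimate by 2 \<pi> exp s0. The
  common constant comes from 6 + 2 \<pi> \<le> 13 in the Laplacian terms and from 4 = 2 * 2 in the
  jump terms.\<close>

lemma error_bound:
  fixes C N L s0 s1 :: real
  assumes C: "0 \<le> C" and N: "0 \<le> N" "N \<le> 2 * N'" and s: "0 \<le> s1" "s1 \<le> s0"
  shows "exp (- s0) / (2 * pi) * (4 * pi * C * exp (s0 - 5 / 12 * L) + 4 * pi * C * exp (- s0)
      + 4 * pi\<^sup>2 * C * exp (- s0 / 4) + 12 / 5 * N * exp ((s0 - s1) / 6)
      + (8 * pi * C * exp (- s1 / 4) + 6 * N * exp ((s0 - s1) / 6)) + pi * N) \<le>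
    (13 * C + 4) * exp (- 5 / 12 * L) + (13 * C + 4) * exp (- s1 / 4) * exp (- s0)
      + (13 * C + 4) * exp (- s1) * N'"
proof -
  \<comment> \<open>The growth exp ((s0 - s1) / 6) is weakened to d = exp (s0 - s1), so that
    division by exp s0 leaves precisely exp (- s1) = 1 / r1.\<close>
  define e q d where "e = exp (- s0)" and "q = exp (- s1 / 4)" and "d = exp (s0 - s1)"
  have pi: "3 \<le> pi" "pi \<le> 3.2" using pi_approx by simp_all
  have "exp (- s0) \<le> q" "exp (- s0 / 4) \<le> q" using s by (simp_all add: q_def)
  then have q: "4 * pi * C * exp (- s0) \<le> 4 * pi * C * q"
    "4 * pi\<^sup>2 * C * exp (- s0 / 4) \<le> 4 * pi\<^sup>2 * C * q"
    using C by (auto intro!: mult_left_mono)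
  have d: "exp ((s0 - s1) / 6) \<le> d" "1 \<le> d" using s by (simp_all add: d_def)
  then have "12 / 5 * N * exp ((s0 - s1) / 6) \<le> 12 / 5 * N * d"
    "6 * N * exp ((s0 - s1) / 6) \<le> 6 * N * d" "pi * N * 1 \<le> pi * N * d"
    using N mult_left_mono[OF d(2), of "pi * N"] by (auto intro!: mult_left_mono)
  with q have "4 * pi * C * exp (s0 - 5 / 12 * L) + 4 * pi * C * exp (- s0)
      + 4 * pi\<^sup>2 * C * exp (- s0 / 4) + 12 / 5 * N * exp ((s0 - s1) / 6)
      + (8 * pi * C * exp (- s1 / 4) + 6 * N * exp ((s0 - s1) / 6)) + pi * N \<le>
    4 * pi * C * exp (s0 - 5 / 12 * L) + (12 * pi * C + 4 * pi\<^sup>2 * C) * q + (42 / 5 + pi) * (N * d)"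
    unfolding q_def[symmetric] by (simp add: algebra_simps)
  then have "exp (- s0) / (2 * pi) * (4 * pi * C * exp (s0 - 5 / 12 * L) + 4 * pi * C * exp (- s0)
      + 4 * pi\<^sup>2 * C * exp (- s0 / 4) + 12 / 5 * N * exp ((s0 - s1) / 6)
      + (8 * pi * C * exp (- s1 / 4) + 6 * N * exp ((s0 - s1) / 6)) + pi * N) \<le>
    exp (- s0) / (2 * pi) * (4 * pi * C * exp (s0 - 5 / 12 * L) + (12 * pi * C + 4 * pi\<^sup>2 * C) * q
      + (42 / 5 + pi) * (N * d))"
    by (intro mult_left_mono) auto
  also have "\<dots> = 2 * C * (exp (- s0) * exp (s0 - 5 / 12 * L)) + (6 * C + 2 * pi * C) * q * e
      + (42 / 5 + pi) / (2 * pi) * N * (exp (- s0) * d)"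
    unfolding e_def by (simp add: field_simps power2_eq_square)
  also have "exp (- s0) * exp (s0 - 5 / 12 * L) = exp (- 5 / 12 * L)" by (simp flip: exp_add)
  also have "exp (- s0) * d = exp (- s1)" by (simp add: d_def flip: exp_add)
  also have "2 * C * exp (- 5 / 12 * L) \<le> (13 * C + 4) * exp (- 5 / 12 * L)"
    using C by (intro mult_right_mono) auto
  also have "(6 * C + 2 * pi * C) * q * e \<le> (13 * C + 4) * q * e"
  proof -
    have "2 * pi * C \<le> 2 * 3.2 * C" using pi C by (intro mult_right_mono) auto
    then have "6 * C + 2 * pi * C \<le> 13 * C + 4" using C by linarith
    then show ?thesis by (intro mult_right_mono) (auto simp: q_def e_def)
  qed
  also have "(42 / 5 + pi) / (2 * pi) * N * exp (- s1) \<le> (13 * C + 4) * exp (- s1) * N'"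
  proof -
    \<comment> \<open>Here 42/5 = 12/5 + 6 collects the jumps at the pole and the radial move; the
      inequality amounts to 42/5 \<le> 3 \<pi>.\<close>
    have "(42 / 5 + pi) / (2 * pi) \<le> 2" using pi by (simp add: field_simps)
    then have "(42 / 5 + pi) / (2 * pi) * N \<le> 2 * (2 * N')"
      using N pi by (intro mult_mono) auto
    also have "\<dots> \<le> (13 * C + 4) * N'" using C N by (simp add: distrib_right)
    finally have "(42 / 5 + pi) / (2 * pi) * N \<le> (13 * C + 4) * N'" .
    from mult_right_mono[OF this, of "exp (- s1)"] show ?thesis by (simp add: mult_ac)
  qed
  finally show ?thesis by (simp add: q_def e_def)
qed

theorem lemma14p1:
  fixes C :: real
  assumes "C > 0"
  shows "\<exists>C1::real. \<forall>(R::real) (u :: real \<times> real \<Rightarrow> real) (\<epsilon>::real).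
    R > 1 \<longrightarrow>
    C2_on (polar_sector 1 (sqrt R) (- pi) (3 * pi)) u \<longrightarrow>
    (\<forall>\<zeta> \<in> polar_sector 1 (sqrt R) (- pi) pi. separation u \<zeta> \<noteq> 0) \<longrightarrow>
    0 < \<epsilon> \<longrightarrow> \<epsilon> < 1 / (2 * pi) \<longrightarrow>
    (\<forall>\<zeta> \<in> polar_sector 1 (sqrt R) (- pi) (3 * pi).
       cmod (complex_gradient u \<zeta>) \<le> C * fst \<zeta> powr (- 5 / 12) \<and>
       \<bar>laplacian u \<zeta>\<bar> \<le> C * fst \<zeta> powr (- 9 / 4)) \<longrightarrow>
    (\<forall>\<zeta> \<in> polar_sector 1 (sqrt R) (- pi) pi.
       fst \<zeta> * (norm (gradient (separation u) \<zeta>) / \<bar>separation u \<zeta>\<bar>) \<le> \<epsilon>) \<longrightarrow>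
    (\<forall>r1::real. r1 \<ge> 1 \<longrightarrow> 2 * r1 \<le> sqrt R / 2 \<longrightarrow>
      (\<exists>(b::real) (c::real) (g :: real \<times> real \<Rightarrow> complex).
        \<forall>\<zeta> \<in> polar_sector (2 * r1) (sqrt R / 2) 0 (2 * pi).
          complex_gradient u \<zeta> =
            (of_real b + \<i> * of_real c / (2 * of_real pi)) * inverse (cover_proj \<zeta>) + g \<zeta> \<and>
          cmod (g \<zeta>) \<le> C1 * R powr (- 5 / 24)
                      + C1 * r1 powr (- 1 / 4) * inverse (fst \<zeta>)
                      + C1 * \<epsilon> * inverse r1 * \<bar>separation u (r1, 0)\<bar>))"
proof (rule exI[of _ "13 * C + 4"], intro allI impI)
  fix R \<epsilon> r1 :: real and u :: "real \<times> real \<Rightarrow> real"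
  assume R: "R > 1" and C2: "C2_on (polar_sector 1 (sqrt R) (- pi) (3 * pi)) u"
    and w_nz: "\<forall>\<zeta> \<in> polar_sector 1 (sqrt R) (- pi) pi. separation u \<zeta> \<noteq> 0"
    and \<epsilon>: "0 < \<epsilon>" "\<epsilon> < 1 / (2 * pi)"
    and bounds: "\<forall>\<zeta> \<in> polar_sector 1 (sqrt R) (- pi) (3 * pi).
       cmod (complex_gradient u \<zeta>) \<le> C * fst \<zeta> powr (- 5 / 12) \<and>
       \<bar>laplacian u \<zeta>\<bar> \<le> C * fst \<zeta> powr (- 9 / 4)"
    and w_grad: "\<forall>\<zeta> \<in> polar_sector 1 (sqrt R) (- pi) pi.
       fst \<zeta> * (norm (gradient (separation u) \<zeta>) / \<bar>separation u \<zeta>\<bar>) \<le> \<epsilon>"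
    and r1: "r1 \<ge> 1" "2 * r1 \<le> sqrt R / 2"
  define L s1 where "L = ln (sqrt R)" and "s1 = ln r1"
  have expL: "exp L = sqrt R" and exps1: "exp s1 = r1" using R r1 by (simp_all add: L_def s1_def)
  have s1: "0 \<le> s1" "s1 \<le> L" using r1 R by (auto simp: L_def s1_def)
  have sector: "(exp s, t) \<in> polar_sector 1 (sqrt R) a b" if "s \<in> {0..L}" "t \<in> {a..b}" for s t a b
    using that by (simp add: polar_sector_def univ_cover_def flip: expL)
  obtain U where U: "open U" "polar_sector 1 (sqrt R) (- pi) (3 * pi) \<subseteq> U" "C2_open U u"
    using C2 by (auto simp: C2_on_def)
  have memU: "(exp s, t) \<in> U" if "s \<in> {0..L}" "t \<in> {- pi..3 * pi}" for s t
    using sector[OF that] U(2) by auto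
  have w: "separation u differentiable (at \<zeta>)"
    "complex_gradient (separation u) \<zeta> =
      complex_gradient u (fst \<zeta>, snd \<zeta> + 2 * pi) - complex_gradient u \<zeta>"
    if \<zeta>: "\<zeta> \<in> polar_sector 1 (sqrt R) (- pi) pi" for \<zeta>
  proof -
    obtain \<rho> \<theta> where z: "\<zeta> = (\<rho>, \<theta>)" by (cases \<zeta>)
    have "(\<rho>, \<theta>) \<in> U" "(\<rho>, \<theta> + 2 * pi) \<in> U" "\<rho> > 0"
      using \<zeta> U(2) by (auto simp: z polar_sector_def univ_cover_def)
    note * = complex_gradient_separation[OF C2_open_differentiable(1)[OF U(1,3) this(1)]
        C2_open_differentiable(1)[OF U(1,3) this(2)] this(3)]
    show "separation u differentiable (at \<zeta>)"
      "complex_gradient (separation u) \<zeta> =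
        complex_gradient u (fst \<zeta>, snd \<zeta> + 2 * pi) - complex_gradient u \<zeta>"
      using * by (simp_all add: z)
  qed
  have w_grad': "fst \<zeta> * norm (gradient (separation u) \<zeta>) \<le> \<epsilon> * \<bar>separation u \<zeta>\<bar>"
    if "\<zeta> \<in> polar_sector 1 (sqrt R) (- pi) pi" for \<zeta>
    using w_grad[rule_format, OF that] w_nz[rule_format, OF that] by (simp add: field_simps)
  define w1 where "w1 = \<bar>separation u (r1, 0)\<bar>"
  \<comment> \<open>The factor exp (1/2) pays for the arc from angle 0 to an angle t with |t| \<le>
    \<pi>, since \<epsilon> \<pi> < 1/2.\<close>
  define N where "N = \<epsilon> * (exp (1 / 2) * w1)"
  have \<epsilon>6: "\<epsilon> \<le> 1 / 6" and \<epsilon>pi: "\<epsilon> * pi \<le> 1 / 2"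
  proof -
    have "1 / (2 * pi) \<le> 1 / 6" using pi_gt3 by (intro divide_left_mono) auto
    then show "\<epsilon> \<le> 1 / 6" using \<epsilon>(2) by linarith
    show "\<epsilon> * pi \<le> 1 / 2" using \<epsilon>(2) by (simp add: field_simps)
  qed
  interpret log_strip "log_gradient u" "log_gradient_s u" "log_gradient_t u" L C N s1
  proof
    fix s t assume st: "s \<in> {0..L}" "t \<in> {- pi..3 * pi}"
    note m = memU[OF st]
    note b = bounds[rule_format, OF sector[OF st]]
    show "((\<lambda>s. log_gradient u s t) has_vector_derivative log_gradient_s u s t) (at s)"
      "(log_gradient u s has_vector_derivative log_gradient_t u s t) (at t)"
      by (rule log_gradient_has_vector_derivative[OF U(1,3) m])+
    have "cmod (log_gradient u s t) \<le> exp s * (C * exp s powr (- 5 / 12))"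
      using b by (simp add: log_gradient_def norm_mult)
    also have "\<dots> = C * exp (s + s * (- 5 / 12))"
      by (simp only: exp_powr_real exp_add mult.left_commute)
    also have "s + s * (- 5 / 12) = 7 / 12 * s" by simp
    finally show "cmod (log_gradient u s t) \<le> C * exp (7 / 12 * s)" .
    have "cmod (log_gradient_s u s t + \<i> * log_gradient_t u s t) = exp (2 * s) * \<bar>laplacian u (exp s, t)\<bar>"
      unfolding log_gradient_dbar[OF U(1,3) m] norm_of_real by (simp add: abs_mult)
    also have "\<dots> \<le> exp (2 * s) * (C * exp s powr (- 9 / 4))"
      using b by (intro mult_left_mono) auto
    also have "\<dots> = C * exp (2 * s + s * (- 9 / 4))"
      by (simp only: exp_powr_real exp_add mult.left_commute)
    also have "2 * s + s * (- 9 / 4) = - s / 4" by simp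
    finally show "cmod (log_gradient_s u s t + \<i> * log_gradient_t u s t) \<le> C * exp (- s / 4)" .
  next
    have "(exp s, t) \<in> U" if "(s, t) \<in> {0..L} \<times> {- pi..3 * pi}" for s t
      using memU that by auto
    note c = continuous_on_log_gradient[OF U(1,3) this]
    show "continuous_on ({0..L} \<times> {- pi..3 * pi}) (\<lambda>(s, t). log_gradient u s t)"
      "continuous_on ({0..L} \<times> {- pi..3 * pi}) (\<lambda>(s, t). log_gradient_s u s t)"
      "continuous_on ({0..L} \<times> {- pi..3 * pi}) (\<lambda>(s, t). log_gradient_t u s t)"
      by (rule c; assumption)+
  next
    fix s t assume st: "s \<in> {0..L}" "t \<in> {- pi..pi}"
    note m = sector[OF st]
    have m1: "(exp s1, 0) \<in> polar_sector 1 (sqrt R) (- pi) pi"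
      using s1 by (intro sector) auto
    have "exp (Complex s (t + 2 * pi)) = exp (Complex s t)"
      by (simp add: exp_eq_polar complex_eq_iff)
    then have "log_gradient u s (t + 2 * pi) - log_gradient u s t =
        exp (Complex s t) * complex_gradient (separation u) (exp s, t)"
      using w(2)[OF m] by (simp add: log_gradient_def right_diff_distrib)
    then have "cmod (log_gradient u s (t + 2 * pi) - log_gradient u s t) =
        exp s * norm (gradient (separation u) (exp s, t))"
      by (simp add: norm_mult norm_gradient)
    also have "\<dots> \<le> \<epsilon> * \<bar>separation u (exp s, t)\<bar>" using w_grad'[OF m] by simp
    also have "\<dots> \<le> \<epsilon> * (exp (\<epsilon> * (\<bar>s - s1\<bar> + \<bar>t - 0\<bar>)) * \<bar>separation u (exp s1, 0)\<bar>)"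
      using separation_growth[OF w(1) w_grad' m1 m] \<epsilon> by (intro mult_left_mono) auto
    also have "\<dots> \<le> \<epsilon> * (exp (1 / 2 + \<bar>s - s1\<bar> / 6) * w1)"
    proof -
      have "\<epsilon> * \<bar>t\<bar> \<le> \<epsilon> * pi" using st \<epsilon> by (intro mult_left_mono) auto
      moreover have "\<epsilon> * \<bar>s - s1\<bar> \<le> 1 / 6 * \<bar>s - s1\<bar>" using \<epsilon>6 by (intro mult_right_mono) auto
      ultimately have "\<epsilon> * (\<bar>s - s1\<bar> + \<bar>t - 0\<bar>) \<le> 1 / 2 + \<bar>s - s1\<bar> / 6"
        using \<epsilon>pi by (simp add: distrib_left)
      then show ?thesis
        unfolding w1_def exps1 using \<epsilon> by (intro mult_left_mono mult_right_mono) auto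
    qed
    finally show "cmod (log_gradient u s (t + 2 * pi) - log_gradient u s t) \<le> N * exp (\<bar>s - s1\<bar> / 6)"
      by (simp add: N_def exp_add mult_ac)
  qed (use assms s1 in auto)
  \<comment> \<open>This depends on r1 but not on \<zeta>. Its real and imaginary parts yield b = Re
    a and c = 2 \<pi> Im a, the latter undoing the normalisation i c / (2 \<pi>).\<close>
  define a where "a = mean pi s1 / (2 * of_real pi)"
  define g where "g = (\<lambda>\<zeta>. complex_gradient u \<zeta> -
      (of_real (Re a) + \<i> * of_real (2 * pi * Im a) / (2 * of_real pi)) * inverse (cover_proj \<zeta>))"
  have a_eq: "of_real (Re a) + \<i> * of_real (2 * pi * Im a) / (2 * of_real pi) = a"
    by (simp add: complex_eq_iff)
  have "cmod (g \<zeta>) \<le> (13 * C + 4) * R powr (- 5 / 24) + (13 * C + 4) * r1 powr (- 1 / 4) * inverse (fst \<zeta>)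
      + (13 * C + 4) * \<epsilon> * inverse r1 * \<bar>separation u (r1, 0)\<bar>"
    if \<zeta>: "\<zeta> \<in> polar_sector (2 * r1) (sqrt R / 2) 0 (2 * pi)" for \<zeta>
  proof -
    obtain \<rho> t where z: "\<zeta> = (\<rho>, t)" by (cases \<zeta>)
    have \<rho>: "0 < \<rho>" "2 * r1 \<le> \<rho>" "\<rho> \<le> sqrt R / 2" and t: "t \<in> {0..2 * pi}"
      using \<zeta> by (auto simp: z polar_sector_def univ_cover_def)
    define s where "s = ln \<rho>"
    have exps: "exp s = \<rho>" using \<rho> by (simp add: s_def)
    have "ln (r1 * 2) \<le> s" unfolding s_def using \<rho> r1 by (intro ln_mono) auto
    moreover have "s \<le> ln (sqrt R / 2)" unfolding s_def using \<rho> R by (intro ln_mono) auto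
    \<comment> \<open>The factors 2 in the radii of the smaller sector become the margins ln 2
      required by the strip estimate.\<close>
    ultimately have s: "s1 + ln 2 \<le> s" "s \<le> L - ln 2"
      using r1 R by (simp_all add: ln_mult ln_div s1_def L_def)
    define X where "X = 2 * of_real pi * log_gradient u s t - mean pi s1"
    have "g \<zeta> = X / (2 * of_real pi * exp (Complex s t))"
      unfolding g_def a_eq z exps[symmetric] cover_proj_exp X_def
      by (simp add: a_def log_gradient_def field_simps)
    then have "cmod (g \<zeta>) = cmod X / (2 * pi * exp s)"
      by (simp add: norm_divide norm_mult)
    also have "\<dots> = exp (- s) / (2 * pi) * cmod X"
      by (simp add: exp_minus field_simps)
    also have "\<dots> \<le> exp (- s) / (2 * pi) * (4 * pi * C * exp (s - 5 / 12 * L) + 4 * pi * C * exp (- s)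
      + 4 * pi\<^sup>2 * C * exp (- s / 4) + 12 / 5 * N * exp ((s - s1) / 6)
      + (8 * pi * C * exp (- s1 / 4) + 6 * N * exp ((s - s1) / 6)) + pi * N)"
      unfolding X_def using strip_estimate[OF t s] by (intro mult_left_mono) auto
    also have "\<dots> \<le> (13 * C + 4) * exp (- 5 / 12 * L) + (13 * C + 4) * exp (- s1 / 4) * exp (- s)
      + (13 * C + 4) * exp (- s1) * (\<epsilon> * w1)"
    proof (rule error_bound[OF C N_nonneg _ s1(1)])
      \<comment> \<open>The square of the left side is e \<le> 3 < 4.\<close>
      have "exp (1 / 2) \<le> (2::real)"
      proof (rule power2_le_imp_le)
        show "(exp (1 / 2))\<^sup>2 \<le> (2::real)\<^sup>2" using exp_le by (simp flip: exp_double)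
      qed simp
      then have "\<epsilon> * (exp (1 / 2) * w1) \<le> \<epsilon> * (2 * w1)"
        using \<epsilon> by (intro mult_left_mono mult_right_mono) (auto simp: w1_def)
      then show "N \<le> 2 * (\<epsilon> * w1)" by (simp add: N_def)
      have "0 < ln (2 :: real)" by simp
      with s show "s1 \<le> s" by linarith
    qed
    also have "exp (- 5 / 12 * L) = R powr (- 5 / 24)"
      using R by (simp add: powr_def L_def ln_sqrt)
    also have "exp (- s1 / 4) = r1 powr (- 1 / 4)"
      using r1 by (simp add: powr_def s1_def)
    also have "exp (- s) = inverse (fst \<zeta>)" by (simp add: exp_minus exps z)
    also have "exp (- s1) = inverse r1" by (simp add: exp_minus exps1)
    finally show ?thesis by (simp add: w1_def mult_ac)
  qed
  then show "\<exists>(b::real) (c::real) (g :: real \<times> real \<Rightarrow> complex).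
        \<forall>\<zeta> \<in> polar_sector (2 * r1) (sqrt R / 2) 0 (2 * pi).
          complex_gradient u \<zeta> =
            (of_real b + \<i> * of_real c / (2 * of_real pi)) * inverse (cover_proj \<zeta>) + g \<zeta> \<and>
          cmod (g \<zeta>) \<le> (13 * C + 4) * R powr (- 5 / 24)
                      + (13 * C + 4) * r1 powr (- 1 / 4) * inverse (fst \<zeta>)
                      + (13 * C + 4) * \<epsilon> * inverse r1 * \<bar>separation u (r1, 0)\<bar>"
    by (intro exI[of _ "Re a"] exI[of _ "2 * pi * Im a"] exI[of _ g]) (auto simp: g_def)
qed

end
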